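(* Let $n > 4.6\cdot 10^{13}$ be an integer with $\gcd(n,6)=1$, and let $S=(a_1)(a_2)(a_3)(a_4)$ be a minimal zero-sum sequence of length $4$ over $\mathbb{Z}/n\mathbb{Z}$ such that $\gcd(n,a_i)=1$ for all $i\in\{1,2,3,4\}$. Then $\operatorname{ind}(S)=1$.
   Context: Elements of $G=\mathbb{Z}/n\mathbb{Z}$ are identified with integers in $\{0,1,\dots,n-1\}$; for an integer $y$, $(y)_n$ denotes the least nonnegative representative of $y$ modulo $n$. A sequence $(a_1)\cdots(a_k)$ over $G$ (a multiset of elements, order irrelevant) is zero-sum if $\sum_i a_i\equiv 0 \pmod n$, and minimal zero-sum if it is zero-sum and no proper nonempty subsequence is zero-sum. The index of $S=(a_1)\cdots(a_k)$ is $\operatorname{ind}(S)=\min\left\{\frac{1}{n}\sum_{i=1}^k (g a_i)_n : 1\le g< n,\ \gcd(g,n)=1\right\}$. *)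

theory Defs
  imports Complex_Main "HOL-Library.Multiset" "HOL-Number_Theory.Cong"
begin

text \<open>The elements of \<open>\<int>/n\<int>\<close> are represented by the natural numbers in \<open>{0..<n}\<close>, and a
  sequence over \<open>\<int>/n\<int>\<close> is a multiset of such representatives. Accordingly the least
  nonnegative representative of \<open>y\<close> modulo \<open>n\<close> is \<open>y mod n\<close>.\<close>

definition seq_over :: "nat \<Rightarrow> nat multiset \<Rightarrow> bool" where
  "seq_over n S \<longleftrightarrow> set_mset S \<subseteq> {0..<n}"

definition zero_sum :: "nat \<Rightarrow> nat multiset \<Rightarrow> bool" where
  "zero_sum n S \<longleftrightarrow> [\<Sum>\<^sub># S = 0] (mod n)"

definition minimal_zero_sum :: "nat \<Rightarrow> nat multiset \<Rightarrow> bool" where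
  "minimal_zero_sum n S \<longleftrightarrow>
     zero_sum n S \<and> (\<forall>T. T \<subset># S \<and> T \<noteq> {#} \<longrightarrow> \<not> zero_sum n T)"

text \<open>The set under the minimum is finite, and it is nonempty for \<open>n \<ge> 2\<close> (it contains the
  term for \<open>g = 1\<close>); for \<open>n \<le> 1\<close> the value is unspecified.\<close>

definition seq_index :: "nat \<Rightarrow> nat multiset \<Rightarrow> real" where
  "seq_index n S =
     Min {1 / real n * real (\<Sum>a\<in>#S. (g * a) mod n) | g. 1 \<le> g \<and> g < n \<and> gcd g n = 1}"

end

theory Submission
  imports Defs "HOL-Number_Theory.Number_Theory"
begin

text \<open>
  If the index is not 1, then replacing \<open>g\<close> by \<open>-g\<close> shows that
  \<open>\<Sum>\<^sub>i (g a\<^sub>i)\<^sub>n = 2 n\<close> for every unit \<open>g\<close>. Pairing these identities with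
  \<open>sin (2 \<pi> u g / n)\<close> and summing over the units \<open>g\<close> turns them, by Moebius inversion and the finite
  Fourier expansion of the sawtooth, into the vanishing of
  \<open>\<Sum>\<^sub>i \<Sum>\<^sub>d \<mu>(d) cot (\<pi> u d / (n a\<^sub>i))\<close>, where \<open>1 / a\<^sub>i\<close> is the inverse modulo \<open>n\<close>, for every unit \<open>u\<close>.
  Combining \<open>u = 6 v, 3 v, 2 v, v\<close> removes the frequencies divisible by 2 or 3. Choose \<open>v\<close> with
  \<open>6 v \<equiv> a\<^sub>1\<close>. The sum belonging to \<open>a\<^sub>i\<close> is then, up to \<open>O(2\<^sup>\<omega> \<surd>n)\<close>, either negligible or
  \<open>\<mu>(d\<^sub>0) \<phi>(n) / (\<kappa> \<phi>(d\<^sub>0))\<close>, where \<open>\<kappa>\<close> is coprime to 6 and \<open>a\<^sub>1 / a\<^sub>i \<equiv> \<kappa>\<close> modulo \<open>n / d\<^sub>0\<close>.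
  It equals about \<open>\<phi>(n)\<close> for \<open>i = 1\<close>, and it is at least about \<open>-\<phi>(n) / 4\<close> for the other three, since
  \<open>\<kappa> = -1, d\<^sub>0 = 1\<close> would mean \<open>a\<^sub>1 + a\<^sub>i \<equiv> 0\<close>. For large \<open>n\<close> the total cannot vanish.
\<close>

section \<open>The cotangent\<close>

text \<open>Valid at the poles as well, where \<open>cot\<close> is a quotient by 0 and hence 0. The
  instance \<open>x = 0\<close> gives \<open>cot (pi * k) = 0\<close>, the default value that
  appears for modulus 1.\<close>

lemma cot_add_int_pi: "cot (x + pi * of_int k) = cot (x::real)"
proof -
  have s: "sin (pi * of_int k) = (0::real)" by (simp add: sin_zero_iff_int2)
  with sin_cos_squared_add[of "pi * of_int k :: real"] have "cos (pi * of_int k) \<noteq> (0::real)"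
    by auto
  with s show ?thesis by (simp add: cot_def sin_add cos_add)
qed

lemma mult_cos_le_sin:
  fixes x :: real
  assumes "0 \<le> x" "x \<le> pi"
  shows "x * cos x \<le> sin x"
proof -
  have "sin 0 - 0 * cos 0 \<le> sin x - x * cos x"
  proof (rule DERIV_nonneg_imp_nondecreasing[OF assms(1)])
    fix t assume t: "0 \<le> t" "t \<le> x"
    have "((\<lambda>t. sin t - t * cos t) has_real_derivative t * sin t) (at t)"
      by (auto intro!: derivative_eq_intros simp: algebra_simps)
    moreover have "0 \<le> t * sin t" using t assms by (simp add: sin_ge_zero)
    ultimately show "\<exists>y. ((\<lambda>t. sin t - t * cos t) has_real_derivative y) (at t) \<and> 0 \<le> y"
      by blast
  qed
  then show ?thesis by simp
qed

lemma cot_bounds: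
  fixes x :: real
  assumes "0 < x" "x \<le> pi / 2"
  shows "0 \<le> cot x" "cot x \<le> 1 / x" "1 / x - 1 \<le> cot x"
proof -
  have s: "sin x > 0" using assms by (simp add: sin_gt_zero)
  have c: "cos x \<ge> 0" using assms by (simp add: cos_ge_zero)
  show "0 \<le> cot x" using s c by (simp add: cot_def)
  show "cot x \<le> 1 / x" using mult_cos_le_sin[of x] s assms by (simp add: cot_def field_simps)
  \<comment> \<open>The lower bound with denominators cleared. For \<open>x \<ge> 1\<close> the left
    side is nonpositive; otherwise \<open>1 - x \<le> cos x\<close> and \<open>sin x \<le> x\<close>
    suffice.\<close>
  have "(1 - x) * sin x \<le> x * cos x"
  proof (cases "x \<ge> 1")
    case True
    then have "(1 - x) * sin x \<le> 0" using s by (simp add: mult_nonpos_nonneg)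
    also have "0 \<le> x * cos x" using c assms by simp
    finally show ?thesis .
  next
    case False
    have "\<bar>sin (x / 2)\<bar> \<le> \<bar>x / 2\<bar>" by (rule abs_sin_x_le_abs_x)
    then have "(sin (x / 2))\<^sup>2 \<le> (x / 2)\<^sup>2" by (simp only: abs_le_square_iff)
    moreover have "cos x = 1 - 2 * (sin (x / 2))\<^sup>2" using cos_double_sin[of "x / 2"] by simp
    ultimately have "cos x \<ge> 1 - x\<^sup>2 / 2" by (simp add: power2_eq_square)
    moreover have "x\<^sup>2 / 2 \<le> x" using False assms by (simp add: power2_eq_square)
    ultimately have "1 - x \<le> cos x" by linarith
    have "sin x \<le> x" using assms by (simp add: sin_x_le_x)
    then have "(1 - x) * sin x \<le> (1 - x) * x" using False by (intro mult_left_mono) auto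
    also have "\<dots> \<le> cos x * x" using \<open>1 - x \<le> cos x\<close> assms by (intro mult_right_mono) auto
    finally show ?thesis by (simp add: mult.commute)
  qed
  then show "1 / x - 1 \<le> cot x" using s assms by (simp add: cot_def field_simps)
qed

lemma abs_cot_diff_le:
  fixes x :: real
  assumes "x \<noteq> 0" "\<bar>x\<bar> \<le> pi / 2"
  shows "\<bar>cot x - 1 / x\<bar> \<le> 1" "\<bar>cot x\<bar> \<le> 1 / \<bar>x\<bar>"
proof -
  have "\<bar>cot x - 1 / x\<bar> \<le> 1 \<and> \<bar>cot x\<bar> \<le> 1 / \<bar>x\<bar>"
  proof (cases "x > 0")
    case True
    with cot_bounds[of x] assms show ?thesis by simp
  next
    case False
    with cot_bounds[of "- x"] assms show ?thesis by simp
  qed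
  then show "\<bar>cot x - 1 / x\<bar> \<le> 1" "\<bar>cot x\<bar> \<le> 1 / \<bar>x\<bar>" by simp_all
qed

text \<open>By \<open>N * cot (N * t) = (\<Sum>j<N. cot (t + j * pi / N))\<close> the four terms are
  one sixth of the sums of \<open>cot (t + j * pi / 6)\<close> over all j modulo 6, the even j, the
  j divisible by 3, and j = 0. Inclusion-exclusion leaves the j coprime to 6, namely 1 and -1. The
  proof checks the result by direct trigonometry.\<close>

lemma cot_combination:
  fixes t :: real
  assumes "sin (6 * t) \<noteq> 0"
  shows "cot (6 * t) - cot (3 * t) / 2 - cot (2 * t) / 3 + cot t / 6
    = (cot (t - pi / 6) + cot (t + pi / 6)) / 6"
proof -
  define s c where "s = sin t" and "c = cos t"
  have sc: "s\<^sup>2 + c\<^sup>2 = 1" by (simp add: s_def c_def)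
  have s2: "sin (2 * t) = 2 * s * c" and c2: "cos (2 * t) = c\<^sup>2 - s\<^sup>2"
    by (simp_all add: s_def c_def sin_double cos_double)
  have s3: "sin (3 * t) = s * (3 * c\<^sup>2 - s\<^sup>2)"
  proof -
    have "sin (3 * t) = sin (2 * t) * c + cos (2 * t) * s"
      using sin_add[of "2 * t" t] by (simp add: s_def c_def)
    then show ?thesis unfolding s2 c2 by (simp add: power2_eq_square algebra_simps)
  qed
  have c3: "cos (3 * t) = c * (c\<^sup>2 - 3 * s\<^sup>2)"
  proof -
    have "cos (3 * t) = cos (2 * t) * c - sin (2 * t) * s"
      using cos_add[of "2 * t" t] by (simp add: s_def c_def)
    then show ?thesis unfolding s2 c2 by (simp add: power2_eq_square algebra_simps)
  qed
  have s6: "sin (6 * t) = 2 * sin (3 * t) * cos (3 * t)"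
    and c6: "cos (6 * t) = (cos (3 * t))\<^sup>2 - (sin (3 * t))\<^sup>2"
    using sin_double[of "3 * t"] cos_double[of "3 * t"] by simp_all
  have nz: "s \<noteq> 0" "c \<noteq> 0" "3 * c\<^sup>2 - s\<^sup>2 \<noteq> 0" "c\<^sup>2 - 3 * s\<^sup>2 \<noteq> 0"
    using assms s6 s3 c3 by auto
  \<comment> \<open>\<open>e6\<close> and \<open>e2\<close> are
    \<open>cot (2 * u) - cot u / 2 = - tan u / 2\<close> at \<open>u = 3 * t\<close> and
    \<open>u = t\<close>; the left side becomes \<open>tan t / 6 - tan (3 * t) / 2\<close>.\<close>
  have e6: "cot (6 * t) - cot (3 * t) / 2 = - (sin (3 * t) / cos (3 * t)) / 2"
  proof -
    have "sin (3 * t) \<noteq> 0" "cos (3 * t) \<noteq> 0" using nz s3 c3 by auto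
    then show ?thesis unfolding cot_def s6 c6
      by (simp add: diff_divide_distrib power2_eq_square)
  qed
  have e2: "cot t / 6 - cot (2 * t) / 3 = (s / c) / 6"
    using nz unfolding cot_def s2 c2 s_def[symmetric] c_def[symmetric]
    by (simp add: field_simps power2_eq_square)
  define r where "r = sqrt (3::real)"
  have r: "r * r = 3" by (simp add: r_def)
  have sm: "sin (t - pi / 6) = (r * s - c) / 2" and cm: "cos (t - pi / 6) = (r * c + s) / 2"
    and sp: "sin (t + pi / 6) = (r * s + c) / 2" and cp: "cos (t + pi / 6) = (r * c - s) / 2"
    unfolding sin_diff cos_diff sin_add cos_add sin_30 cos_30 s_def[symmetric] c_def[symmetric]
      r_def[symmetric] by (simp_all add: field_simps)
  have "(r * s - c) * (r * s + c) = 3 * s\<^sup>2 - c\<^sup>2"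
    using r by (simp add: power2_eq_square algebra_simps)
  then have nz': "(r * s - c) * (r * s + c) \<noteq> 0" using nz by auto
  have "cot (t - pi / 6) + cot (t + pi / 6) = (r * c + s) / (r * s - c) + (r * c - s) / (r * s + c)"
  proof -
    have "(u / 2) / (v / 2) = u / v" for u v :: real by simp
    then show ?thesis by (simp only: cot_def sm cm sp cp)
  qed
  also have "\<dots> = ((r * c + s) * (r * s + c) + (r * c - s) * (r * s - c)) / ((r * s - c) * (r * s + c))"
    using nz' by (intro add_frac_eq) auto
  also have "(r * c + s) * (r * s + c) + (r * c - s) * (r * s - c) = 2 * (r * r) * s * c + 2 * s * c"
    by (simp add: algebra_simps)
  also have "\<dots> = 8 * s * c" using r by simp
  also have "(r * s - c) * (r * s + c) = 3 * s\<^sup>2 - c\<^sup>2" by fact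
  finally have rhs: "cot (t - pi / 6) + cot (t + pi / 6) = 8 * s * c / (3 * s\<^sup>2 - c\<^sup>2)" .
  have "3 * s\<^sup>2 - c\<^sup>2 \<noteq> 0" using nz by auto
  have "(s / c) / 6 - (s * (3 * c\<^sup>2 - s\<^sup>2) / (c * (c\<^sup>2 - 3 * s\<^sup>2))) / 2
      = s * ((c\<^sup>2 - 3 * s\<^sup>2) - 3 * (3 * c\<^sup>2 - s\<^sup>2)) / (6 * c * (c\<^sup>2 - 3 * s\<^sup>2))"
    using nz by (simp add: divide_simps) (simp add: algebra_simps)
  also have "\<dots> = 8 * s * c / (3 * s\<^sup>2 - c\<^sup>2) / 6"
    using nz \<open>3 * s\<^sup>2 - c\<^sup>2 \<noteq> 0\<close> by (simp add: divide_simps) (simp add: algebra_simps power2_eq_square)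
  finally show ?thesis using e6 e2 rhs s3 c3 by simp
qed

text \<open>Summation by parts, meant for a root of unity \<open>w \<noteq> 1\<close> with
  \<open>w ^ M = 1\<close>, where the right side is just \<open>M\<close>.\<close>

lemma sum_linear_power:
  fixes w :: "'a::comm_ring_1"
  shows "(w - 1) * (\<Sum>h<M. of_nat h * w ^ h) = of_nat M * w ^ M - (\<Sum>h<M. w ^ Suc h)"
  by (induction M) (auto simp: algebra_simps)

text \<open>For \<open>m = 1\<close> the right-hand side is \<open>0\<close>, because \<open>cot\<close> is a quotient with denominator \<open>0\<close>.\<close>

lemma sum_linear_sin:
  fixes b :: int and m :: nat
  assumes "m > 0" "m = 1 \<or> \<not> int m dvd b"
  shows "(\<Sum>h<m. real h * sin (2 * pi * of_int b * real h / real m))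
    = - real m / 2 * cot (pi * of_int b / real m)"
proof (cases "m = 1")
  case True
  then show ?thesis using cot_add_int_pi[of 0 b] by simp
next
  case False
  with assms have nd: "\<not> int m dvd b" by simp
  define a where "a = pi * of_int b / real m"
  define w where "w = cis (2 * a)"
  have sa: "sin a \<noteq> 0"
  proof
    assume "sin a = 0"
    then obtain i :: int where "a = of_int i * pi" by (auto simp: sin_zero_iff_int2)
    then have "real_of_int b = real_of_int i * real m"
      using assms(1) by (simp add: a_def field_simps)
    then have "b = i * int m" by (metis of_int_eq_iff of_int_mult of_int_of_nat_eq)
    with nd show False by simp
  qed
  have wm: "w ^ m = 1"
  proof -
    have "w ^ m = cis (2 * pi * of_int b)"
      unfolding w_def Complex.DeMoivre a_def using assms(1) by (simp add: field_simps)
    also have "\<dots> = 1" by (simp add: cis_multiple_2pi)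
    finally show ?thesis .
  qed
  have re: "Re (w - 1) = - 2 * sin a * sin a" and im: "Im (w - 1) = 2 * sin a * cos a"
    using cos_double_sin[of a] sin_double[of a] by (simp_all add: w_def power2_eq_square)
  have w1: "w \<noteq> 1" using re sa by auto
  have "(\<Sum>h<m. w ^ Suc h) = w * (\<Sum>h<m. w ^ h)" by (simp add: sum_distrib_left)
  also have "\<dots> = 0" using geometric_sum[OF w1, of m] wm by simp
  finally have S: "(w - 1) * (\<Sum>h<m. of_nat h * w ^ h) = of_nat m"
    using sum_linear_power[of w m] wm by simp
  define X where "X = (\<Sum>h<m. of_nat h * w ^ h)"
  have R: "Re ((w - 1) * X) = real m" and I: "Im ((w - 1) * X) = 0" using S by (simp_all add: X_def)
  have R': "- (2 * sin a * sin a) * Re X - 2 * sin a * cos a * Im X = real m"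
    using R unfolding times_complex.sel re im by simp
  have I': "- (2 * sin a * sin a) * Im X + 2 * sin a * cos a * Re X = 0"
    using I unfolding times_complex.sel re im by simp
  have "2 * sin a * (cos a * Re X - sin a * Im X) = 0" using I' by (simp add: algebra_simps)
  then have I2: "sin a * Im X = cos a * Re X" using sa by simp
  \<comment> \<open>Multiplying \<open>R'\<close> by \<open>cos a\<close> and replacing
    \<open>cos a * Re X\<close> through \<open>I2\<close> eliminates \<open>Re X\<close>.\<close>
  have "- 2 * ((sin a)\<^sup>2 + (cos a)\<^sup>2) * (sin a * Im X) = real m * cos a"
  proof -
    have "- 2 * (x\<^sup>2 + z\<^sup>2) * (x * t) = - 2 * x * x * (x * t) - 2 * z * z * x * t" for x z t :: real
      by (simp add: power2_eq_square algebra_simps)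
    then have "- 2 * ((sin a)\<^sup>2 + (cos a)\<^sup>2) * (sin a * Im X)
      = - 2 * sin a * sin a * (sin a * Im X) - 2 * cos a * cos a * sin a * Im X" .
    also have "\<dots> = cos a * (- (2 * sin a * sin a) * Re X - 2 * sin a * cos a * Im X)"
      unfolding I2 by (simp add: algebra_simps)
    also have "\<dots> = real m * cos a" unfolding R' by simp
    finally show ?thesis .
  qed
  then have "- 2 * (sin a * Im X) = real m * cos a"
    by (simp only: sin_cos_squared_add mult_1_right)
  then have "Im X = - real m / 2 * cot a" using sa by (simp add: cot_def field_simps)
  moreover have "Im X = (\<Sum>h<m. real h * sin (2 * pi * of_int b * real h / real m))"
    unfolding X_def w_def Complex.DeMoivre a_def
    by (simp add: mult_ac)
  ultimately show ?thesis by (simp add: a_def)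
qed

section \<open>Sums over the residues coprime to n\<close>

lemma prod_primes_dvd_iff:
  fixes A :: "nat set" and x :: nat
  assumes "finite A" "\<And>p. p \<in> A \<Longrightarrow> prime p"
  shows "\<Prod>A dvd x \<longleftrightarrow> (\<forall>p\<in>A. p dvd x)"
  using assms
proof (induction A rule: finite_induct)
  case (insert p A)
  have "coprime p (\<Prod>A)"
    using insert.prems insert.hyps by (intro prod_coprime_right primes_coprime) auto
  then have "p * \<Prod>A dvd x \<longleftrightarrow> p dvd x \<and> \<Prod>A dvd x"
    using divides_mult[of p x "\<Prod>A"] by (auto dest: dvd_mult_left dvd_mult_right)
  then show ?case using insert by simp
qed simp

lemma gcd_prod_primes:
  fixes A B :: "nat set"
  assumes "finite A" "finite B" "\<And>p. p \<in> A \<union> B \<Longrightarrow> prime p"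
  shows "gcd (\<Prod>A) (\<Prod>B) = \<Prod>(A \<inter> B)"
proof -
  have A: "\<Prod>A = \<Prod>(A \<inter> B) * \<Prod>(A - B)" and B: "\<Prod>B = \<Prod>(A \<inter> B) * \<Prod>(B - A)"
    using prod.Int_Diff[OF assms(1), of "\<lambda>x. x" B] prod.Int_Diff[OF assms(2), of "\<lambda>x. x" A]
    by (simp_all add: Int_commute)
  have "coprime (\<Prod>(A - B)) (\<Prod>(B - A))"
    by (intro prod_coprime_left prod_coprime_right primes_coprime) (use assms in auto)
  then show ?thesis unfolding A B by (simp add: gcd_mult_left)
qed

text \<open>Moebius inversion with squarefree divisors encoded as sets \<open>A\<close> of primes,
  so that mu(d) for d = \<open>\<Prod>A\<close> is \<open>(- 1) ^ card A\<close>. The indicator of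
  coprimality is the product of \<open>1 - of_bool (p dvd h)\<close> over the primes p of n,
  expanded over subsets.\<close>

lemma sum_coprime_moebius:
  fixes F :: "nat \<Rightarrow> 'a::comm_ring_1"
  assumes "n > 0"
  shows "(\<Sum>h | h < n \<and> coprime h n. F h)
    = (\<Sum>A\<in>Pow (prime_factors n). (- 1) ^ card A * (\<Sum>k < n div \<Prod>A. F (\<Prod>A * k)))"
proof -
  let ?P = "prime_factors n"
  have ind: "(\<Sum>A\<in>Pow ?P. (- 1) ^ card A * of_bool (\<Prod>A dvd h)) = (of_bool (coprime h n) :: 'a)" for h
  proof -
    have "(\<Sum>A\<in>Pow ?P. (- 1) ^ card A * of_bool (\<Prod>A dvd h))
      = (\<Sum>A\<in>Pow ?P. (- 1) ^ card A * (\<Prod>p\<in>A. of_bool (p dvd h)) * (\<Prod>p\<in>?P - A. 1::'a))"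
    proof (intro sum.cong refl)
      fix A assume A: "A \<in> Pow ?P"
      then have f: "finite A" by (auto intro: finite_subset)
      have "\<Prod>A dvd h \<longleftrightarrow> (\<forall>p\<in>A. p dvd h)"
        using A by (intro prod_primes_dvd_iff[OF f]) auto
      moreover have "(\<Prod>p\<in>A. of_bool (p dvd h)) = (of_bool (\<forall>p\<in>A. p dvd h) :: 'a)"
        using f by (induction A rule: finite_induct) auto
      ultimately show "(- 1) ^ card A * of_bool (\<Prod>A dvd h)
        = (- 1) ^ card A * (\<Prod>p\<in>A. of_bool (p dvd h)) * (\<Prod>p\<in>?P - A. 1::'a)" by simp
    qed
    also have "\<dots> = (\<Prod>p\<in>?P. 1 - of_bool (p dvd h))"
      by (rule prod_diff_conv_sum[symmetric]) simp
    also have "\<dots> = (of_bool (\<forall>p\<in>?P. \<not> p dvd h) :: 'a)"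
      by (induction rule: finite_induct[OF finite_set_mset]) auto
    also have "(\<forall>p\<in>?P. \<not> p dvd h) \<longleftrightarrow> coprime h n"
    proof
      assume *: "\<forall>p\<in>?P. \<not> p dvd h"
      show "coprime h n"
      proof (rule ccontr)
        assume "\<not> coprime h n"
        then obtain p where "prime p" "p dvd gcd h n"
          by (metis coprime_iff_gcd_eq_1 prime_factor_nat)
        with * assms show False by (auto simp: in_prime_factors_iff)
      qed
    next
      assume *: "coprime h n"
      show "\<forall>p\<in>?P. \<not> p dvd h"
        using * by (metis coprime_common_divisor in_prime_factors_iff not_prime_unit)
    qed
    finally show ?thesis .
  qed
  have "(\<Sum>h | h < n \<and> coprime h n. F h) = (\<Sum>h<n. of_bool (coprime h n) * F h)"
    by (intro sum.mono_neutral_cong_left) auto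
  also have "\<dots> = (\<Sum>h<n. \<Sum>A\<in>Pow ?P. (- 1) ^ card A * (of_bool (\<Prod>A dvd h) * F h))"
    by (simp only: ind[symmetric] sum_distrib_right mult.assoc)
  also have "\<dots> = (\<Sum>A\<in>Pow ?P. (- 1) ^ card A * (\<Sum>h<n. of_bool (\<Prod>A dvd h) * F h))"
    by (subst sum.swap) (simp only: sum_distrib_left)
  also have "\<dots> = (\<Sum>A\<in>Pow ?P. (- 1) ^ card A * (\<Sum>k < n div \<Prod>A. F (\<Prod>A * k)))"
  proof (rule sum.cong[OF refl])
    fix A assume "A \<in> Pow ?P"
    then have A: "finite A" "\<And>p. p \<in> A \<Longrightarrow> prime p" "\<And>p. p \<in> A \<Longrightarrow> p dvd n"
      by (auto intro: finite_subset)
    have "\<Prod>A dvd n"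
      using prod_primes_dvd_iff[OF A(1,2)] A(3) by simp
    then obtain m where m: "n = \<Prod>A * m" by blast
    have pos: "\<Prod>A > 0" using A by (simp add: prod_pos prime_gt_0_nat)
    have "(\<Sum>h<n. of_bool (\<Prod>A dvd h) * F h) = (\<Sum>h | h < n \<and> \<Prod>A dvd h. F h)"
      by (intro sum.mono_neutral_cong_right) (auto simp: of_bool_def)
    also have "\<dots> = (\<Sum>k<m. F (\<Prod>A * k))"
    proof (rule sum.reindex_bij_witness[where i = "\<lambda>k. \<Prod>A * k" and j = "\<lambda>h. h div \<Prod>A"])
      fix h assume "h \<in> {h. h < n \<and> \<Prod>A dvd h}"
      then obtain k where "h = \<Prod>A * k" "\<Prod>A * k < \<Prod>A * m" using m by auto
      then show "\<Prod>A * (h div \<Prod>A) = h" "h div \<Prod>A \<in> {..<m}" "F (\<Prod>A * (h div \<Prod>A)) = F h"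
        using pos by simp_all
    qed (use pos m in auto)
    also have "m = n div \<Prod>A" using pos m by simp
    finally show "(- 1) ^ card A * (\<Sum>h<n. of_bool (\<Prod>A dvd h) * F h)
        = (- 1) ^ card A * (\<Sum>k < n div \<Prod>A. F (\<Prod>A * k))"
      by (simp only:)
  qed
  finally show ?thesis .
qed

text \<open>This is the main term mu(d0) phi(n) / phi(d0) with d0 = \<open>\<Prod>A0\<close>.
  Writing \<open>A = A0 \<union> B\<close> leaves an Euler product over the primes outside
  \<open>A0\<close>, which is phi(n) / n divided by the factors \<open>1 - 1 / p\<close> with p in
  \<open>A0\<close>.\<close>

lemma signed_sum_supersets:
  assumes "n > 0" "A0 \<subseteq> prime_factors n"
  shows "(\<Sum>A | A0 \<subseteq> A \<and> A \<subseteq> prime_factors n. (- 1) ^ card A * (real n / real (\<Prod>A)))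
    = (- 1) ^ card A0 * real (totient n) / real (\<Prod>p\<in>A0. p - 1)"
proof -
  let ?P = "prime_factors n"
  have fin: "finite A0" using assms finite_subset by blast
  have zero_notin: "0 \<notin> A0" using assms by auto
  have "(\<Sum>A | A0 \<subseteq> A \<and> A \<subseteq> ?P. (- 1) ^ card A * (real n / real (\<Prod>A)))
      = (\<Sum>B\<in>Pow (?P - A0). (- 1) ^ card (A0 \<union> B) * (real n / real (\<Prod>(A0 \<union> B))))"
    using assms by (intro sum.reindex_bij_witness[where i = "\<lambda>B. A0 \<union> B" and j = "\<lambda>A. A - A0"])
      (auto simp: Un_absorb1)
  also have "\<dots> = (\<Sum>B\<in>Pow (?P - A0). (- 1) ^ card A0 * (real n / real (\<Prod>A0)) *
        ((- 1) ^ card B * (\<Prod>p\<in>B. 1 / real p) * (\<Prod>p\<in>?P - A0 - B. 1)))"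
  proof (intro sum.cong refl)
    fix B assume B: "B \<in> Pow (?P - A0)"
    then have "finite B" "A0 \<inter> B = {}" by (auto intro: finite_subset)
    then show "(- 1) ^ card (A0 \<union> B) * (real n / real (\<Prod>(A0 \<union> B))) =
      (- 1) ^ card A0 * (real n / real (\<Prod>A0)) *
        ((- 1) ^ card B * (\<Prod>p\<in>B. 1 / real p) * (\<Prod>p\<in>?P - A0 - B. 1))"
      using fin by (simp add: card_Un_disjoint prod.union_disjoint power_add prod_dividef)
  qed
  also have "\<dots> = (- 1) ^ card A0 * (real n / real (\<Prod>A0)) * (\<Prod>p\<in>?P - A0. 1 - 1 / real p)"
    unfolding sum_distrib_left[symmetric] by (subst prod_diff_conv_sum) simp_all
  also have "(\<Prod>p\<in>?P - A0. 1 - 1 / real p) = (\<Prod>p\<in>?P. 1 - 1 / real p) / (\<Prod>p\<in>A0. 1 - 1 / real p)"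
  proof -
    have "(\<Prod>p\<in>A0. 1 - 1 / real p) \<noteq> 0"
      using assms fin by (auto simp: in_prime_factors_iff)
    then show ?thesis using assms by (simp add: prod.subset_diff[of A0 ?P])
  qed
  also have "(\<Prod>p\<in>A0. 1 - 1 / real p) = real (\<Prod>p\<in>A0. p - 1) / real (\<Prod>A0)"
  proof -
    have "(\<Prod>p\<in>A0. 1 - 1 / real p) = (\<Prod>p\<in>A0. real (p - 1) / real p)"
      using assms prime_gt_0_nat by (intro prod.cong) (auto simp: of_nat_diff field_simps Suc_leI in_prime_factors_iff)
    then show ?thesis by (simp add: prod_dividef)
  qed
  finally show ?thesis
    using fin zero_notin by (simp add: totient_formula2)
qed

lemma prod_prime_factors_subset:
  fixes n :: nat
  assumes "n > 0" "A \<subseteq> prime_factors n"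
  shows "\<Prod>A dvd n" "\<Prod>A > 0"
proof -
  have A: "finite A" "\<And>p. p \<in> A \<Longrightarrow> prime p" "\<And>p. p \<in> A \<Longrightarrow> p dvd n"
    using assms by (auto intro: finite_subset)
  show "\<Prod>A dvd n" using prod_primes_dvd_iff[OF A(1,2)] A(3) by simp
  show "\<Prod>A > 0" using A by (simp add: prod_pos prime_gt_0_nat)
qed


section \<open>Comparison of 2^omega(n) sqrt(n) with phi(n) for n coprime to 6\<close>

lemma cube_ratio_le:
  fixes p :: nat
  assumes "prime p" "p \<noteq> 2" "p \<noteq> 3"
  shows "(2 * real p / real (p - 1)) ^ 3 \<le> real p * (if p = 5 then 25/8 else if p = 7 then 49/27 else 1)"
\<comment> \<open>The two exceptional factors are chosen to give equality at 5 and 7. From 11 on the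
  ratio decreases while p grows, and \<open>(22 / 10) ^ 3 = 10.648\<close> is below 11, so the
  factor 1 suffices.\<close>
proof (cases "p = 5 \<or> p = 7")
  case True
  then show ?thesis by (auto simp: power3_eq_cube)
next
  case False
  have "\<not> prime (4::nat)" "\<not> prime (6::nat)" "\<not> prime (8::nat)" "\<not> prime (9::nat)" "\<not> prime (10::nat)"
    by simp_all
  then have "p \<noteq> 4" "p \<noteq> 6" "p \<noteq> 8" "p \<noteq> 9" "p \<noteq> 10" "p \<noteq> 0" "p \<noteq> 1" using assms(1) by auto
  then have "p \<ge> 11" using assms(2,3) False by arith
  then obtain q where q: "p = q + 11" by (metis add.commute le_Suc_ex)
  have "8 * (real q + 11) ^ 3 \<le> (real q + 11) * (real q + 10) ^ 3"
  proof -
    have "(real q + 11) * (real q + 10) ^ 3 - 8 * (real q + 11) ^ 3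
      = (real q + 11) * (real q ^ 3 + 22 * real q ^ 2 + 124 * real q + 32)"
      by (simp add: power3_eq_cube power2_eq_square algebra_simps)
    also have "\<dots> \<ge> 0" by simp
    finally show ?thesis by simp
  qed
  then have "8 * (real q + 11) ^ 3 / (real q + 10) ^ 3 \<le> real q + 11"
    by (simp add: divide_le_eq)
  moreover have "(2 * real p / real (p - 1)) ^ 3 = 8 * real p ^ 3 / real (p - 1) ^ 3"
    by (simp only: power_divide power_mult_distrib) simp
  moreover have "real p = real q + 11" "real (p - 1) = real q + 10" by (simp_all add: q)
  ultimately show ?thesis using False by (simp add: add.commute)
qed

lemma prime_factor_coprime_6:
  assumes "coprime n 6" "p \<in> prime_factors (n::nat)"
  shows "p \<noteq> 2" "p \<noteq> 3"
proof -
  have "\<not> p dvd 6"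
    using assms by (metis coprime_common_divisor in_prime_factors_iff not_prime_unit)
  then show "p \<noteq> 2" "p \<noteq> 3" by auto
qed

lemma prod_prime_factors_le:
  assumes "n > 0"
  shows "(\<Prod>p\<in>prime_factors n. real p) \<le> real n"
proof -
  have "\<Prod>(prime_factors n) dvd n" using prod_prime_factors_subset(1)[OF assms order_refl] .
  then have "real (\<Prod>(prime_factors n)) \<le> real n" using assms by (simp add: dvd_imp_le del: of_nat_prod)
  then show ?thesis by simp
qed

text \<open>The quotient 2^omega(n) n / phi(n) is the product of \<open>2 * p / (p - 1)\<close> over
  the primes of n. Bounding the cube of each factor by \<open>cube_ratio_le\<close> gives at most n
  times the exceptional factors, and \<open>25/8 * 49/27 = 1225/216\<close>.\<close>

lemma totient_cube_bound:
  assumes "n > 0" "coprime n 6"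
  shows "(2 ^ card (prime_factors n) * real n) ^ 3 \<le> 1225 / 216 * real n * real (totient n) ^ 3"
proof -
  let ?P = "prime_factors n"
  define c :: "nat \<Rightarrow> real" where "c p = (if p = 5 then 25/8 else if p = 7 then 49/27 else 1)" for p
  \<comment> \<open>All \<open>c p\<close> are at least 1, so adjoining 5 and 7 when they do not
    divide n only enlarges the product.\<close>
  have "(\<Prod>p\<in>?P. c p) \<le> (\<Prod>p\<in>?P \<union> {5, 7}. c p)"
    by (intro prod_mono2) (auto simp: c_def)
  also have "\<dots> = (\<Prod>p\<in>{5, 7}. c p)"
    by (intro prod.mono_neutral_right) (auto simp: c_def)
  finally have c: "(\<Prod>p\<in>?P. c p) \<le> 1225 / 216" by (simp add: c_def)
  have tot: "real (totient n) = real n * (\<Prod>p\<in>?P. real (p - 1) / real p)"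
  proof -
    have "(\<Prod>p\<in>?P. 1 - 1 / real p) = (\<Prod>p\<in>?P. real (p - 1) / real p)"
      by (intro prod.cong refl)
        (auto simp: of_nat_diff field_simps Suc_leI prime_gt_0_nat in_prime_factors_iff)
    then show ?thesis by (simp only: totient_formula2)
  qed
  have p1: "real (p - 1) > 0" "real p > 0" if "p \<in> ?P" for p
    using that prime_gt_1_nat[of p] by (auto simp: in_prime_factors_iff)
  have "(\<Prod>p\<in>?P. 2 * real p / real (p - 1)) * (\<Prod>p\<in>?P. real (p - 1) / real p) = 2 ^ card ?P"
  proof -
    have "(\<Prod>p\<in>?P. 2 * real p / real (p - 1)) * (\<Prod>p\<in>?P. real (p - 1) / real p)
      = (\<Prod>p\<in>?P. 2 * real p / real (p - 1) * (real (p - 1) / real p))"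
      by (rule prod.distrib[symmetric])
    also have "\<dots> = (\<Prod>p\<in>?P. 2)"
    proof (rule prod.cong[OF refl])
      fix p assume "p \<in> ?P"
      from p1[OF this] show "2 * real p / real (p - 1) * (real (p - 1) / real p) = 2"
        by (simp only: times_divide_times_eq) (simp add: mult_ac del: of_nat_diff)
    qed
    finally show ?thesis by simp
  qed
  then have "2 ^ card ?P * real n = (\<Prod>p\<in>?P. 2 * real p / real (p - 1)) * real (totient n)"
    unfolding tot by simp
  then have "(2 ^ card ?P * real n) ^ 3 = (\<Prod>p\<in>?P. (2 * real p / real (p - 1)) ^ 3) * real (totient n) ^ 3"
    by (simp only: power_mult_distrib prod_power_distrib)
  also have "\<dots> \<le> (\<Prod>p\<in>?P. real p * c p) * real (totient n) ^ 3"
  proof (intro mult_right_mono prod_mono conjI)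
    fix p assume "p \<in> ?P"
    then show "(2 * real p / real (p - 1)) ^ 3 \<le> real p * c p"
      unfolding c_def using prime_factor_coprime_6[OF assms(2)] by (intro cube_ratio_le) auto
  qed simp_all
  also have "(\<Prod>p\<in>?P. real p * c p) = (\<Prod>p\<in>?P. c p) * (\<Prod>p\<in>?P. real p)"
    by (simp add: prod.distrib)
  also have "\<dots> * real (totient n) ^ 3 \<le> (1225 / 216 * real n) * real (totient n) ^ 3"
    using c prod_prime_factors_le[OF assms(1)]
    by (intro mult_right_mono mult_mono) (auto intro: prod_nonneg)
  finally show ?thesis .
qed

lemma totient_gt:
  assumes "coprime n 6" "real n > 4.6 * 10 ^ 13"
  shows "96 * (2 ^ card (prime_factors n) * sqrt (real n)) < real (totient n)"
proof (rule ccontr)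
  define s where "s = sqrt (real n)"
  define w :: real where "w = 2 ^ card (prime_factors n)"
  assume "\<not> ?thesis"
  then have le: "real (totient n) \<le> 96 * (w * s)" by (simp add: s_def w_def)
  have n: "real n = s\<^sup>2" by (simp add: s_def)
  \<comment> \<open>\<open>5017600 = 1225/216 * 96^3\<close> is the constant that the cube bound
    produces from the negated claim; its square lies below \<open>4.6 * 10^13\<close>.\<close>
  have s: "s > 5017600"
  proof (rule power2_less_imp_less)
    show "5017600\<^sup>2 < s\<^sup>2" using assms(2) n by (simp add: power2_eq_square)
  qed (simp add: s_def)
  have w: "w > 0" by (simp add: w_def)
  have "n > 0" using assms(2) by (cases n) auto
  from totient_cube_bound[OF this assms(1)]
  have "(w * s\<^sup>2) ^ 3 \<le> 1225 / 216 * s\<^sup>2 * real (totient n) ^ 3" by (simp only: n w_def)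
  also have "\<dots> \<le> 1225 / 216 * s\<^sup>2 * (96 * (w * s)) ^ 3"
    using le by (intro mult_left_mono power_mono) auto
  also have "\<dots> = 5017600 * (w ^ 3 * s ^ 5)"
    by (simp add: power_mult_distrib power2_eq_square power3_eq_cube numeral_eq_Suc)
  also have "(w * s\<^sup>2) ^ 3 = s * (w ^ 3 * s ^ 5)" by (simp add: eval_nat_numeral)
  finally have "s * (w ^ 3 * s ^ 5) \<le> 5017600 * (w ^ 3 * s ^ 5)" .
  then show False using s w by simp
qed

section \<open>A vanishing sum of cotangents\<close>

text \<open>The finite sine transform of the sawtooth, restricted to the units modulo n.\<close>

definition totatives_sum :: "nat \<Rightarrow> int \<Rightarrow> real" where
  "totatives_sum n b = (\<Sum>h | h < n \<and> coprime h n. real h / real n * sin (2 * pi * of_int b * real h / real n))"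

text \<open>After Moebius inversion the inner sum runs over the multiples of \<open>\<Prod>A\<close>
  and becomes a full sawtooth sum modulo \<open>n div \<Prod>A\<close>, evaluated by
  \<open>sum_linear_sin\<close>.\<close>

lemma totatives_sum_eq:
  assumes "n > 0" "coprime b (int n)"
  shows "totatives_sum n b
    = - (\<Sum>A\<in>Pow (prime_factors n). (- 1) ^ card A * cot (pi * of_int b / real (n div \<Prod>A))) / 2"
proof -
  have "totatives_sum n b = (\<Sum>A\<in>Pow (prime_factors n). (- 1) ^ card A * (\<Sum>k < n div \<Prod>A.
      real (\<Prod>A * k) / real n * sin (2 * pi * of_int b * real (\<Prod>A * k) / real n)))"
    unfolding totatives_sum_def by (rule sum_coprime_moebius) fact
  also have "\<dots> = (\<Sum>A\<in>Pow (prime_factors n). (- 1) ^ card A *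
      (- cot (pi * of_int b / real (n div \<Prod>A)) / 2))"
  proof (intro sum.cong refl arg_cong2[where f = "(*)"])
    fix A assume "A \<in> Pow (prime_factors n)"
    then have d: "\<Prod>A dvd n" "\<Prod>A > 0" using prod_prime_factors_subset[OF assms(1)] by auto
    define d where "d = \<Prod>A"
    obtain m where m: "n = d * m" using d(1) unfolding d_def by blast
    have "m > 0" "d > 0" using m assms(1) by auto
    have "coprime b (int m)" using assms(2) m by simp
    \<comment> \<open>\<open>m = 1\<close> occurs when n is squarefree and \<open>A\<close> contains
      all its primes; both sides are then 0.\<close>
    then have "m = 1 \<or> \<not> int m dvd b"
      by (metis coprime_common_divisor dvd_refl zdvd1_eq abs_of_nat of_nat_1_eq_iff)
    have "(\<Sum>k < n div d. real (d * k) / real n * sin (2 * pi * of_int b * real (d * k) / real n))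
      = (\<Sum>k<m. (real k * sin (2 * pi * of_int b * real k / real m)) / real m)"
      using \<open>d > 0\<close> m by (intro sum.cong) (auto simp: mult_ac)
    also have "\<dots> = (- real m / 2 * cot (pi * of_int b / real m)) / real m"
      unfolding sum_divide_distrib[symmetric]
      by (simp only: sum_linear_sin[OF \<open>m > 0\<close> \<open>m = 1 \<or> \<not> int m dvd b\<close>])
    also have "\<dots> = - cot (pi * of_int b / real (n div d)) / 2"
      using \<open>m > 0\<close> \<open>d > 0\<close> m by simp
    finally show "(\<Sum>k < n div \<Prod>A. real (\<Prod>A * k) / real n * sin (2 * pi * of_int b * real (\<Prod>A * k) / real n))
      = - cot (pi * of_int b / real (n div \<Prod>A)) / 2" unfolding d_def .
  qed
  also have "\<dots> = - (\<Sum>A\<in>Pow (prime_factors n). (- 1) ^ card A * cot (pi * of_int b / real (n div \<Prod>A))) / 2"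
    by (simp add: sum_divide_distrib sum_negf)
  finally show ?thesis .
qed

lemma sin_2pi_cong:
  fixes x y :: int
  assumes "n > 0" "[x = y] (mod int n)"
  shows "sin (2 * pi * of_int x / real n) = sin (2 * pi * of_int y / real n)"
proof -
  obtain k where "y = x + int n * k" using assms(2) by (auto simp: cong_iff_lin)
  then have "2 * pi * of_int y / real n = 2 * pi * of_int x / real n + of_int k * (2 * pi)"
    using assms(1) by (simp add: field_simps)
  also have "sin \<dots> = sin (2 * pi * of_int x / real n)"
    using sin_int_2pin[of k] cos_int_2pin[of k] by (simp add: sin_add mult.commute)
  finally show ?thesis by simp
qed

lemma coprime_diff_left_iff:
  fixes g n :: nat
  assumes "g \<le> n"
  shows "coprime (n - g) n \<longleftrightarrow> coprime g n"
  using assms by (metis coprime_iff_gcd_eq_1 gcd.commute gcd_diff2_nat)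

text \<open>The involution \<open>g \<mapsto> n - g\<close> of the units reverses the sign of each
  term; \<open>n > 1\<close> keeps 0 out of the range of summation.\<close>

lemma sum_coprime_sin_eq_0:
  assumes "n > 1"
  shows "(\<Sum>g | g < n \<and> coprime g n. sin (2 * pi * of_int u * real g / real n)) = 0"
proof -
  let ?U = "{g. g < n \<and> coprime g n}"
  let ?f = "\<lambda>g. sin (2 * pi * of_int u * real g / real n)"
  have pos: "g > 0" if "g \<in> ?U" for g
    using that assms by (cases "g = 0") auto
  have "sum ?f ?U = (\<Sum>g\<in>?U. ?f (n - g))"
    by (rule sum.reindex_bij_witness[where i = "\<lambda>g. n - g" and j = "\<lambda>g. n - g"])
      (use coprime_diff_left_iff pos assms in auto)
  also have "\<dots> = (\<Sum>g\<in>?U. - ?f g)"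
  proof (intro sum.cong refl)
    fix g assume g: "g \<in> ?U"
    have "?f (n - g) = sin (2 * pi * of_int (u * (int n - int g)) / real n)"
      using g by (simp add: of_nat_diff mult.assoc)
    also have "\<dots> = sin (2 * pi * of_int (- (u * int g)) / real n)"
      using assms by (intro sin_2pi_cong) (auto simp: cong_iff_dvd_diff algebra_simps)
    also have "\<dots> = - ?f g" by (simp add: mult.assoc)
    finally show "?f (n - g) = - ?f g" .
  qed
  also have "\<dots> = - sum ?f ?U" by (simp add: sum_negf)
  finally show ?thesis by simp
qed

text \<open>Substitution of \<open>h = g * a mod n\<close>, a permutation of the units whose inverse
  is multiplication by \<open>k\<close>.\<close>

lemma sum_mod_sin_eq_totatives_sum:
  assumes "n > 1" "[a * k = 1] (mod n)"
  shows "(\<Sum>g | g < n \<and> coprime g n. real (g * a mod n) / real n * sin (2 * pi * of_int u * real g / real n))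
    = totatives_sum n (u * int k)"
proof -
  have ca: "coprime a n" using assms(2) by (metis cong_imp_coprime coprime_1_left coprime_mult_left_iff cong_sym)
  have ck: "coprime k n" using assms(2) by (metis cong_imp_coprime coprime_1_left coprime_mult_left_iff cong_sym)
  have inv: "(g * a mod n) * k mod n = g" "(g * k mod n) * a mod n = g" if "g < n" for g
  proof -
    have "[g * (a * k) = g * 1] (mod n)" by (intro cong_mult assms(2) cong_refl)
    then have "g * (a * k) mod n = g" using that by (simp add: cong_def)
    then have "g * a * k mod n = g" "g * k * a mod n = g" by (simp_all add: mult_ac)
    then show "(g * a mod n) * k mod n = g" "(g * k mod n) * a mod n = g"
      by (simp_all add: mod_mult_left_eq)
  qed
  show ?thesis unfolding totatives_sum_def
  proof (rule sum.reindex_bij_witness[where i = "\<lambda>h. h * k mod n" and j = "\<lambda>g. g * a mod n"])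
    fix g assume "g \<in> {g. g < n \<and> coprime g n}"
    then have g: "g < n" "coprime g n" by auto
    show "g * a mod n * k mod n = g" using inv g by simp
    show "g * a mod n \<in> {h. h < n \<and> coprime h n}" using g ca assms by simp
    have "[g * a mod n * k = g] (mod n)" using inv(1)[OF g(1)] g(1) by (simp add: cong_def)
    then have "[int (g * a mod n * k) = int g] (mod int n)" by (simp only: cong_int_iff)
    then have "[u * int (g * a mod n * k) = u * int g] (mod int n)"
      by (intro cong_mult cong_refl)
    from sin_2pi_cong[OF _ this] assms
    have "sin (2 * pi * of_int (u * int (g * a mod n * k)) / real n) = sin (2 * pi * of_int (u * int g) / real n)"
      by simp
    then show "real (g * a mod n) / real n * sin (2 * pi * of_int (u * int k) * real (g * a mod n) / real n) =
      real (g * a mod n) / real n * sin (2 * pi * of_int u * real g / real n)"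
      by (simp add: mult_ac)
  next
    fix h assume "h \<in> {h. h < n \<and> coprime h n}"
    then show "h * k mod n * a mod n = h" "h * k mod n \<in> {g. g < n \<and> coprime g n}"
      using inv ck assms by auto
  qed
qed

lemma sum_mset_sum_swap:
  "(\<Sum>a\<in>#S. \<Sum>g\<in>U. f a g) = (\<Sum>g\<in>U. \<Sum>a\<in>#S. (f a g :: 'b::comm_monoid_add))"
  by (induction S) (simp_all add: sum.distrib)

text \<open>By \<open>bal\<close> the fractions \<open>(g * a mod n) / n\<close> add up to 2 for
  every unit g, and a constant paired with the odd function \<open>sin (2 * pi * u * g / n)\<close>
  sums to 0 over the units.\<close>

lemma sum_totatives_sum_eq_0:
  assumes "n > 1"
    and bal: "\<And>g. g < n \<Longrightarrow> coprime g n \<Longrightarrow> (\<Sum>a\<in>#S. (g * a) mod n) = 2 * n"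
    and inv: "\<And>a. a \<in># S \<Longrightarrow> [a * k a = 1] (mod n)"
  shows "(\<Sum>a\<in>#S. totatives_sum n (u * int (k a))) = 0"
proof -
  let ?U = "{g. g < n \<and> coprime g n}"
  let ?s = "\<lambda>g. sin (2 * pi * of_int u * real g / real n)"
  have "(\<Sum>a\<in>#S. totatives_sum n (u * int (k a)))
    = (\<Sum>a\<in>#S. \<Sum>g\<in>?U. real (g * a mod n) / real n * ?s g)"
    using sum_mod_sin_eq_totatives_sum[OF assms(1) inv]
    by (intro arg_cong[where f = sum_mset] image_mset_cong) auto
  also have "\<dots> = (\<Sum>g\<in>?U. \<Sum>a\<in>#S. real (g * a mod n) / real n * ?s g)"
    by (rule sum_mset_sum_swap)
  also have "\<dots> = (\<Sum>g\<in>?U. 2 * ?s g)"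
  proof (intro sum.cong refl)
    fix g assume g: "g \<in> ?U"
    have "(\<Sum>a\<in>#S. real (g * a mod n) / real n * ?s g) = real (\<Sum>a\<in>#S. g * a mod n) * (?s g / real n)"
      by (induction S) (simp_all add: algebra_simps add_divide_distrib)
    also have "\<dots> = 2 * ?s g" using g bal assms(1) by simp
    finally show "(\<Sum>a\<in>#S. real (g * a mod n) / real n * ?s g) = 2 * ?s g" .
  qed
  also have "\<dots> = 0" using sum_coprime_sin_eq_0[OF assms(1)] by (simp add: sum_distrib_left[symmetric])
  finally show ?thesis .
qed

text \<open>By the partial fraction expansion of the cotangent this is, with symmetric summation, m
  times the sum of \<open>1 / k\<close> over k congruent to \<open>y + m\<close> or
  \<open>y - m\<close> modulo \<open>6 * m\<close>. For \<open>6 dvd y\<close> and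
  \<open>coprime m 6\<close> these are exactly the k congruent to y modulo m and coprime to
  6.\<close>

definition cot_pair :: "nat \<Rightarrow> int \<Rightarrow> real" where
  "cot_pair m y = pi / 6 * (cot (pi * of_int (y - int m) / (6 * real m)) + cot (pi * of_int (y + int m) / (6 * real m)))"

definition cot_sum :: "nat \<Rightarrow> int \<Rightarrow> real" where
  "cot_sum n y = (\<Sum>A\<in>Pow (prime_factors n). (- 1) ^ card A * cot_pair (n div \<Prod>A) y)"

lemma cot_pair_eq:
  assumes "m > 0" "coprime x (int m)" "coprime m 6"
  shows "cot_pair m (6 * x) = pi * (cot (pi * of_int (6 * x) / real m) - cot (pi * of_int (3 * x) / real m) / 2
    - cot (pi * of_int (2 * x) / real m) / 3 + cot (pi * of_int x / real m) / 6)"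
proof -
  define t where "t = pi * of_int x / real m"
  have ang: "pi * of_int (6 * x - int m) / (6 * real m) = t - pi / 6"
    "pi * of_int (6 * x + int m) / (6 * real m) = t + pi / 6"
    using assms(1) by (simp_all add: t_def field_simps)
  have "cot (6 * t) - cot (3 * t) / 2 - cot (2 * t) / 3 + cot t / 6
    = (cot (t - pi / 6) + cot (t + pi / 6)) / 6"
  \<comment> \<open>For \<open>m = 1\<close> the identity rests on default values: the four
    cotangents at multiples of pi are 0, and \<open>cot (- (pi / 6))\<close> cancels
    \<open>cot (pi / 6)\<close>.\<close>
  proof (cases "m = 1")
    case True
    then have t: "t = pi * of_int x" by (simp add: t_def)
    have z: "cot (pi * of_int k) = (0::real)" for k using cot_add_int_pi[of 0 k] by simp
    have "cot (t - pi / 6) = cot (- (pi / 6))" "cot (t + pi / 6) = cot (pi / 6)"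
      using cot_add_int_pi[of "- (pi / 6)" x] cot_add_int_pi[of "pi / 6" x] by (simp_all add: t algebra_simps)
    moreover have "cot (6 * t) = 0" "cot (3 * t) = 0" "cot (2 * t) = 0" "cot t = 0"
      using z[of "6 * x"] z[of "3 * x"] z[of "2 * x"] z[of x] by (simp_all add: t mult_ac)
    ultimately show ?thesis by (simp add: cot_minus)
  next
    case False
    show ?thesis
    proof (rule cot_combination, rule notI)
      assume "sin (6 * t) = 0"
      then obtain i :: int where "6 * t = of_int i * pi" by (auto simp: sin_zero_iff_int2)
      then have "real_of_int (6 * x) = real_of_int (i * int m)"
        using assms(1) by (simp add: t_def field_simps)
      then have "int m dvd 6 * x" by (metis dvd_triv_right of_int_eq_iff)
      moreover have "coprime (int m) 6" using assms(3) by (metis coprime_int_iff of_nat_numeral)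
      ultimately have "int m dvd x" by (simp add: coprime_dvd_mult_right_iff)
      then have "int m dvd 1" using assms(2) by (metis coprime_common_divisor dvd_refl)
      with False show False by simp
    qed
  qed
  moreover have "6 * t = pi * of_int (6 * x) / real m" "3 * t = pi * of_int (3 * x) / real m"
    "2 * t = pi * of_int (2 * x) / real m"
    by (simp_all add: t_def)
  ultimately show ?thesis unfolding cot_pair_def ang by (simp add: t_def mult_ac)
qed

lemma cot_sum_eq:
  assumes "n > 0" "coprime x (int n)" "coprime n 6"
  shows "cot_sum n (6 * x) = - 2 * pi * (totatives_sum n (6 * x) - totatives_sum n (3 * x) / 2
    - totatives_sum n (2 * x) / 3 + totatives_sum n x / 6)"
proof -
  let ?C = "\<lambda>b. \<Sum>A\<in>Pow (prime_factors n). (- 1) ^ card A * cot (pi * of_int b / real (n div \<Prod>A))"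
  have "coprime (int n) 6" using assms(3) by (metis coprime_int_iff of_nat_numeral)
  moreover have "(6::int) = 2 * 3" by simp
  ultimately have c: "coprime 6 (int n)" "coprime 2 (int n)" "coprime 3 (int n)"
    by (metis coprime_commute coprime_mult_right_iff)+
  have T: "totatives_sum n (6 * x) = - ?C (6 * x) / 2" "totatives_sum n (3 * x) = - ?C (3 * x) / 2"
    "totatives_sum n (2 * x) = - ?C (2 * x) / 2" "totatives_sum n x = - ?C x / 2"
    by (rule totatives_sum_eq; use assms c in simp)+
  have "cot_sum n (6 * x) = (\<Sum>A\<in>Pow (prime_factors n). (- 1) ^ card A *
    (pi * (cot (pi * of_int (6 * x) / real (n div \<Prod>A)) - cot (pi * of_int (3 * x) / real (n div \<Prod>A)) / 2
    - cot (pi * of_int (2 * x) / real (n div \<Prod>A)) / 3 + cot (pi * of_int x / real (n div \<Prod>A)) / 6)))"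
    unfolding cot_sum_def
  proof (intro sum.cong refl arg_cong2[where f = "(*)"] cot_pair_eq)
    fix A assume "A \<in> Pow (prime_factors n)"
    then have "\<Prod>A dvd n" using prod_prime_factors_subset[OF assms(1)] by auto
    then obtain m where m: "n = \<Prod>A * m" by blast
    with assms(1) have "n div \<Prod>A = m" "m > 0" by (auto simp del: of_nat_prod)
    moreover have "coprime x (int m)" "coprime m 6"
      using assms(2,3) by (simp_all add: m del: of_nat_prod)
    ultimately show "n div \<Prod>A > 0" "coprime x (int (n div \<Prod>A))" "coprime (n div \<Prod>A) 6" by simp_all
  qed
  also have "\<dots> = pi * (?C (6 * x) - ?C (3 * x) / 2 - ?C (2 * x) / 3 + ?C x / 6)"
    unfolding sum_distrib_left sum_divide_distrib sum_subtractf[symmetric] sum.distrib[symmetric]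
    by (intro sum.cong refl) (simp add: algebra_simps)
  finally show ?thesis unfolding T by (simp add: algebra_simps)
qed

text \<open>\<open>sum_totatives_sum_eq_0\<close> at the four frequencies \<open>6 * v\<close>,
  \<open>3 * v\<close>, \<open>2 * v\<close> and \<open>v\<close>, combined by
  \<open>cot_sum_eq\<close>.\<close>

lemma sum_cot_sum_eq_0:
  assumes "n > 1" "coprime n 6"
    and bal: "\<And>g. g < n \<Longrightarrow> coprime g n \<Longrightarrow> (\<Sum>a\<in>#S. (g * a) mod n) = 2 * n"
    and inv: "\<And>a. a \<in># S \<Longrightarrow> [a * k a = 1] (mod n)"
    and v: "coprime v (int n)"
  shows "(\<Sum>a\<in>#S. cot_sum n (6 * (v * int (k a)))) = 0"
proof -
  let ?t = "\<lambda>u. \<Sum>a\<in>#S. totatives_sum n (u * int (k a))"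
  have "coprime (int (k a)) (int n)" if "a \<in># S" for a
    using inv[OF that] by (metis cong_imp_coprime coprime_1_left coprime_mult_left_iff cong_sym coprime_int_iff)
  then have "(\<Sum>a\<in>#S. cot_sum n (6 * (v * int (k a))))
    = (\<Sum>a\<in>#S. - 2 * pi * (totatives_sum n (6 * v * int (k a)) - totatives_sum n (3 * v * int (k a)) / 2
    - totatives_sum n (2 * v * int (k a)) / 3 + totatives_sum n (v * int (k a)) / 6))"
    using assms by (intro arg_cong[where f = sum_mset] image_mset_cong, subst cot_sum_eq) (auto simp: mult.assoc)
  also have "\<dots> = - 2 * pi * (?t (6 * v) - ?t (3 * v) / 2 - ?t (2 * v) / 3 + ?t v / 6)"
    by (induction S) (simp_all add: algebra_simps add_divide_distrib)
  also have "\<dots> = 0" using sum_totatives_sum_eq_0[OF assms(1) bal inv] by simp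
  finally show ?thesis .
qed

section \<open>The size of the cotangent sums\<close>

text \<open>Shifting z by a multiple of N to its residue k of least absolute value puts the angle in
  the range where \<open>\<bar>cot x\<bar> \<le> 1 / \<bar>x\<bar>\<close>.\<close>

lemma abs_cot_le_of_no_small_residue:
  fixes N :: nat and z :: int and R :: real
  assumes "N > 0" "R > 0" and far: "\<And>k. int N dvd z - k \<Longrightarrow> R < \<bar>of_int k\<bar>"
  shows "\<bar>cot (pi * of_int z / real N)\<bar> \<le> real N / (pi * R)"
proof -
  obtain k where k: "int N dvd z - k" "2 * \<bar>k\<bar> \<le> int N"
  proof (cases "2 * (z mod int N) \<le> int N")
    case True
    have "int N dvd z - z mod int N" by simp
    moreover have "0 \<le> z mod int N" using assms(1) by simp
    ultimately show ?thesis using True that[of "z mod int N"] by simp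
  next
    case False
    have "int N dvd (z - z mod int N) + int N" by simp
    then have "int N dvd z - (z mod int N - int N)" by (simp add: algebra_simps)
    moreover have "z mod int N < int N" using assms(1) by simp
    ultimately show ?thesis using False that[of "z mod int N - int N"] by simp
  qed
  have Rk: "R < \<bar>of_int k\<bar>" using far k(1) by blast
  then have k0: "k \<noteq> 0" using assms(2) by auto
  define x where "x = pi * of_int k / real N"
  have x0: "x \<noteq> 0" using k0 assms(1) by (simp add: x_def)
  have ax: "\<bar>x\<bar> = pi * \<bar>of_int k\<bar> / real N" by (simp add: x_def abs_mult)
  have "real_of_int (2 * \<bar>k\<bar>) \<le> real_of_int (int N)" using k(2) by (simp only: of_int_le_iff)
  then have xle: "\<bar>x\<bar> \<le> pi / 2" unfolding ax using assms(1) by (simp add: field_simps)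
  obtain j where "z - k = int N * j" using k(1) by blast
  then have "z = k + int N * j" by simp
  then have "pi * of_int z / real N = x + pi * of_int j"
    using assms(1) by (simp add: x_def field_simps)
  then have "\<bar>cot (pi * of_int z / real N)\<bar> = \<bar>cot x\<bar>" by (simp add: cot_add_int_pi)
  also have "\<dots> \<le> 1 / \<bar>x\<bar>" by (rule abs_cot_diff_le(2)) fact+
  also have "\<dots> = real N / (pi * \<bar>of_int k\<bar>)" by (simp add: ax)
  also have "\<dots> \<le> real N / (pi * R)"
    using Rk assms by (intro divide_left_mono mult_left_mono mult_pos_pos) auto
  finally show ?thesis .
qed

text \<open>With modulus \<open>6 * m\<close> and radius \<open>L / d\<close> the previous bound
  becomes \<open>d * m / L = n / L\<close>, the same for every divisor d.\<close>

lemma abs_cot_term_le: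
  fixes m d n :: nat and z :: int and L :: real
  assumes "n = d * m" "n > 0" "L > 0"
    and far: "\<And>k. int (6 * m) dvd z - k \<Longrightarrow> L < real d * \<bar>of_int k\<bar>"
  shows "\<bar>pi / 6 * cot (pi * of_int z / (6 * real m))\<bar> \<le> real n / L"
proof -
  have pos: "m > 0" "d > 0" using assms(1,2) by auto
  have "\<bar>cot (pi * of_int z / real (6 * m))\<bar> \<le> real (6 * m) / (pi * (L / real d))"
  proof (rule abs_cot_le_of_no_small_residue)
    fix k assume "int (6 * m) dvd z - k"
    then show "L / real d < \<bar>of_int k\<bar>" using far pos by (simp add: field_simps)
  qed (use pos assms(3) in simp_all)
  then have "pi / 6 * \<bar>cot (pi * of_int z / (6 * real m))\<bar> \<le> pi / 6 * (real (6 * m) / (pi * (L / real d)))"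
    by (intro mult_left_mono) simp_all
  also have "\<dots> = real n / L" using pos assms(1,3) by (simp add: field_simps)
  finally show ?thesis by (simp add: abs_mult)
qed

text \<open>If \<open>d * \<bar>k\<bar> \<le> L\<close>, then \<open>\<bar>k\<bar> \<le> m\<close>
  and the error is that of \<open>cot x\<close> against \<open>1 / x\<close>. Otherwise
  \<open>uniq\<close> leaves no residue within the bound, and the cotangent term and
  \<open>m / k\<close> are each at most \<open>n / L\<close> in absolute value.\<close>

lemma abs_cot_term_diff_le:
  fixes m d n :: nat and z k :: int and L :: real
  assumes "n = d * m" "n > 0" "L > 0" "L \<le> n" "k \<noteq> 0" "int (6 * m) dvd z - k"
    and uniq: "\<And>k'. int (6 * m) dvd z - k' \<Longrightarrow> real d * \<bar>of_int k'\<bar> \<le> L \<Longrightarrow> k' = k"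
  shows "\<bar>pi / 6 * cot (pi * of_int z / (6 * real m)) - real m / of_int k\<bar> \<le> 2 * (real n / L)"
proof -
  have pos: "m > 0" "d > 0" using assms(1,2) by auto
  have nL: "1 \<le> real n / L" using assms(3,4) by simp
  show ?thesis
  proof (cases "real d * \<bar>of_int k\<bar> \<le> L")
    case True
    define x where "x = pi * of_int k / (6 * real m)"
    have "real d * \<bar>of_int k\<bar> \<le> real d * real m" using True assms(1,4) by simp
    then have "\<bar>of_int k\<bar> \<le> real m" using pos by simp
    then have x: "x \<noteq> 0" "\<bar>x\<bar> \<le> pi / 2"
      using pos assms(5) by (simp_all add: x_def abs_mult field_simps)
    obtain j where "z - k = int (6 * m) * j" using assms(6) by blast
    then have "z = k + int (6 * m) * j" by simp
    then have "pi * of_int z / (6 * real m) = x + pi * of_int j"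
      using pos by (simp add: x_def field_simps)
    moreover have "real m / of_int k = pi / 6 * (1 / x)" using pos assms(5) by (simp add: x_def)
    ultimately have "pi / 6 * cot (pi * of_int z / (6 * real m)) - real m / of_int k
      = pi / 6 * (cot x - 1 / x)"
      by (simp only: cot_add_int_pi right_diff_distrib)
    then have "\<bar>pi / 6 * cot (pi * of_int z / (6 * real m)) - real m / of_int k\<bar>
      = pi / 6 * \<bar>cot x - 1 / x\<bar>" by (simp only: abs_mult) simp
    also have "\<dots> \<le> pi / 6 * 1" using abs_cot_diff_le(1)[OF x] by (intro mult_left_mono) auto
    also have "\<dots> \<le> 2 * (real n / L)" using nL pi_less_4 by linarith
    finally show ?thesis .
  next
    case False
    have "\<bar>pi / 6 * cot (pi * of_int z / (6 * real m))\<bar> \<le> real n / L"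
    proof (rule abs_cot_term_le[OF assms(1-3)])
      fix k' assume "int (6 * m) dvd z - k'"
      with uniq[of k'] False show "L < real d * \<bar>of_int k'\<bar>" by force
    qed
    moreover have "\<bar>real m / of_int k\<bar> \<le> real n / L"
    proof -
      have "real m / \<bar>of_int k\<bar> = real n / (real d * \<bar>of_int k\<bar>)" using assms(1) pos by simp
      also have "\<dots> \<le> real n / L" using False assms(3) by (intro divide_left_mono) auto
      finally show ?thesis by simp
    qed
    ultimately show ?thesis by linarith
  qed
qed

section \<open>Small representatives coprime to 6 and their uniqueness\<close>

lemma coprime_6_iff_int: "coprime (k::int) 6 \<longleftrightarrow> \<not> 2 dvd k \<and> \<not> 3 dvd k"
proof -
  have "coprime k 6 \<longleftrightarrow> coprime k (2 * 3)" by simp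
  also have "\<dots> \<longleftrightarrow> coprime 2 k \<and> coprime 3 k"
    unfolding coprime_mult_right_iff by (simp add: coprime_commute)
  also have "coprime 3 k \<longleftrightarrow> \<not> 3 dvd k"
  proof -
    have "prime (3::int)" by simp
    then show ?thesis by (metis coprime_absorb_left not_prime_unit prime_imp_coprime)
  qed
  finally show ?thesis by simp
qed

text \<open>With \<open>d = \<Prod>A\<close>, the divisibility says that \<open>k\<close> represents \<open>y\<close> modulo \<open>n / d\<close>.\<close>

definition near :: "nat \<Rightarrow> int \<Rightarrow> real \<Rightarrow> nat set \<Rightarrow> int \<Rightarrow> bool" where
  "near n y L A k \<longleftrightarrow> A \<subseteq> prime_factors n \<and> coprime k 6 \<and> int n dvd int (\<Prod>A) * (y - k) \<and> real (\<Prod>A) * \<bar>of_int k\<bar> \<le> L"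

text \<open>The levels \<open>A\<close> and \<open>A'\<close> may differ: n divides
  \<open>d * d' * (k' - k)\<close>, and d and d' are at most L because k and k' are nonzero, so
  distinct k and k' would force \<open>n \<le> 2 * L\<^sup>2\<close>. Hence a single k governs all
  terms of \<open>cot_sum\<close>.\<close>

lemma near_unique:
  assumes "near n y L A k" "near n y L A' k'" "2 * L\<^sup>2 < real n"
  shows "k = k'"
proof (rule ccontr)
  assume "k \<noteq> k'"
  define d d' where "d = \<Prod>A" and "d' = \<Prod>A'"
  have n: "n > 0" using assms(3) by (metis gr0I not_less of_nat_0 zero_le_power2 mult_nonneg_nonneg zero_le_numeral)
  have pos: "d > 0" "d' > 0"
    using assms(1,2) prod_prime_factors_subset(2)[OF n] by (auto simp: near_def d_def d'_def simp del: of_nat_prod)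
  have "int n dvd int d * (y - k)" "int n dvd int d' * (y - k')"
    using assms(1,2) by (auto simp: near_def d_def d'_def)
  then have "int n dvd int d' * (int d * (y - k)) - int d * (int d' * (y - k'))"
    using dvd_diff dvd_mult by blast
  also have "\<dots> = int d * int d' * (k' - k)" by (simp add: algebra_simps)
  finally have "int n \<le> \<bar>int d * int d' * (k' - k)\<bar>"
    using \<open>k \<noteq> k'\<close> pos by (intro zdvd_imp_le) (auto simp: dvd_abs_iff)
  then have "real_of_int (int n) \<le> real_of_int \<bar>int d * int d' * (k' - k)\<bar>"
    by (simp only: of_int_le_iff)
  then have "real n \<le> real d * real d' * \<bar>of_int (k' - k)\<bar>"
    by (simp add: abs_mult)
  also have "\<dots> \<le> real d * real d' * (\<bar>of_int k'\<bar> + \<bar>of_int k\<bar>)"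
    by (intro mult_left_mono) auto
  also have "\<dots> = real d * (real d' * \<bar>of_int k'\<bar>) + real d' * (real d * \<bar>of_int k\<bar>)"
    by (simp add: algebra_simps)
  finally have le: "real n \<le> real d * (real d' * \<bar>of_int k'\<bar>) + real d' * (real d * \<bar>of_int k\<bar>)" .
  have L: "real d * \<bar>of_int k\<bar> \<le> L" "real d' * \<bar>of_int k'\<bar> \<le> L"
    using assms(1,2) by (auto simp: near_def d_def d'_def)
  have "k \<noteq> 0" "k' \<noteq> 0" using assms(1,2) by (auto simp: near_def)
  then have "1 \<le> \<bar>real_of_int k\<bar>" "1 \<le> \<bar>real_of_int k'\<bar>" by linarith+
  then have "real d * 1 \<le> real d * \<bar>of_int k\<bar>" "real d' * 1 \<le> real d' * \<bar>of_int k'\<bar>"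
    by (intro mult_left_mono; simp)+
  with L have dL: "real d \<le> L" "real d' \<le> L" by linarith+
  have "real d * (real d' * \<bar>of_int k'\<bar>) \<le> L * L" "real d' * (real d * \<bar>of_int k\<bar>) \<le> L * L"
    using L dL pos by (intro mult_mono; simp)+
  with le have "real n \<le> 2 * L\<^sup>2" by (simp add: power2_eq_square)
  with assms(3) show False by simp
qed

section \<open>Estimates of \<open>cot_sum n y\<close> for y divisible by 6\<close>

context
  fixes n :: nat and y :: int and L :: real
  assumes n1: "n > 1" and n6: "coprime n 6" and y6: "6 dvd y" and L1: "L \<ge> 1" and L2: "2 * L\<^sup>2 < real n"
begin

lemma L_le: "L \<le> real n"
proof -
  have "L \<le> L\<^sup>2" using L1 mult_left_mono[of 1 L L] by (simp add: power2_eq_square)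
  then show ?thesis using L2 L1 by linarith
qed

text \<open>Coprimality of k to 6 is automatic: \<open>6 dvd y\<close> makes k congruent to m or -m
  modulo 6, where m = \<open>n div \<Prod>A\<close> divides n and so is coprime to 6.\<close>

lemma near_of_dvd:
  assumes A: "A \<subseteq> prime_factors n" and e: "e = 1 \<or> e = -1"
    and dv: "int (6 * (n div \<Prod>A)) dvd (y + e * int (n div \<Prod>A)) - k" and L: "real (\<Prod>A) * \<bar>of_int k\<bar> \<le> L"
  shows "near n y L A k"
proof -
  define m where "m = n div \<Prod>A"
  have nm: "n = \<Prod>A * m" using prod_prime_factors_subset[OF _ A] n1 by (simp add: m_def)
  have dv: "6 * int m dvd y + e * int m - k" using dv by (simp add: m_def)
  have "coprime (int m) 6" using n6 nm by (metis coprime_int_iff coprime_mult_left_iff of_nat_numeral)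
  then have m6: "\<not> 2 dvd int m" "\<not> 3 dvd int m" by (simp_all only: coprime_6_iff_int simp_thms)
  have "6 dvd y + e * int m - k" using dv by (meson dvd_mult_left)
  then have six: "6 dvd e * int m - k" using y6 by (metis add_diff_eq dvd_add_right_iff)
  have six': "6 dvd int m - k \<or> 6 dvd - int m - k" using six e by auto
  have "\<not> 2 dvd k" using six' m6(1) by presburger
  moreover have "\<not> 3 dvd k" using six' m6(2) by presburger
  ultimately have k6: "coprime k 6" by (simp add: coprime_6_iff_int)
  have "int m dvd y + e * int m - k" using dv by (meson dvd_mult_right)
  then have "int m dvd (y + e * int m - k) - e * int m" by (rule dvd_diff) simp
  then have "int m dvd y - k" by (simp add: algebra_simps)
  then have "int n dvd int (\<Prod>A) * (y - k)" by (simp add: nm mult_dvd_mono)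
  with A L k6 show ?thesis by (simp add: near_def)
qed

text \<open>Write \<open>y - k = m * j\<close>. As 6 divides y and k is coprime to 6, so is j; hence
  j is congruent to exactly one of 1 and -1 modulo 6, which decides which of the two cotangents of
  \<open>cot_pair\<close> has residue k.\<close>

lemma dvd_of_level:
  assumes A: "A \<subseteq> prime_factors n" and k6: "coprime k 6" and dv: "int n dvd int (\<Prod>A) * (y - k)"
  obtains e where "e = 1 \<or> e = -1" "int (6 * (n div \<Prod>A)) dvd (y + e * int (n div \<Prod>A)) - k"
    "\<not> int (6 * (n div \<Prod>A)) dvd (y + (- e) * int (n div \<Prod>A)) - k"
proof -
  define m where "m = n div \<Prod>A"
  have nm: "n = \<Prod>A * m" and pos: "\<Prod>A > 0" using prod_prime_factors_subset[OF _ A] n1 by (simp_all add: m_def)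
  have m: "m > 0" using n1 nm by (metis gr0I mult_0_right not_one_less_zero)
  have "int (\<Prod>A) * int m dvd int (\<Prod>A) * (y - k)" using dv nm by (metis of_nat_mult)
  then have "int m dvd y - k" using pos by (simp add: dvd_mult_cancel_left del: of_nat_prod)
  then obtain j where j: "y - k = int m * j" by blast
  have k: "\<not> 2 dvd k" "\<not> 3 dvd k" using k6 by (simp_all add: coprime_6_iff_int)
  have "\<not> 2 dvd j"
  proof
    assume "2 dvd j"
    then have "2 dvd y - k" using j by simp
    moreover have "2 dvd y" using y6 by presburger
    ultimately show False using k(1) by presburger
  qed
  moreover have "\<not> 3 dvd j"
  proof
    assume "3 dvd j"
    then have "3 dvd y - k" using j by simp
    moreover have "3 dvd y" using y6 by presburger
    ultimately show False using k(2) by presburger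
  qed
  ultimately have "(6 dvd j + 1 \<and> \<not> 6 dvd j + - 1) \<or> (6 dvd j + - 1 \<and> \<not> 6 dvd j + 1)" by presburger
  then obtain e where e: "e = 1 \<or> e = -1" "6 dvd j + e" "\<not> 6 dvd j + - e" by force
  have eq: "(y + f * int m) - k = int m * (j + f)" for f using j by (simp add: algebra_simps)
  have "int (6 * m) dvd (y + f * int m) - k \<longleftrightarrow> 6 dvd j + f" for f
  proof -
    have "int (6 * m) dvd (y + f * int m) - k \<longleftrightarrow> int m * 6 dvd int m * (j + f)"
      unfolding eq by (simp add: mult.commute)
    then show ?thesis using m by simp
  qed
  with e that show ?thesis unfolding m_def by blast
qed

lemma cot_pair_split:
  assumes "e = 1 \<or> e = -1"
  shows "cot_pair m y = pi / 6 * cot (pi * of_int (y + e * int m) / (6 * real m))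
    + pi / 6 * cot (pi * of_int (y + (- e) * int m) / (6 * real m))"
  unfolding cot_pair_def distrib_left using assms by (elim disjE) simp_all

lemma cot_term_small:
  assumes A: "A \<subseteq> prime_factors n" and e: "e = 1 \<or> e = -1"
    and far: "\<And>k. near n y L A k \<Longrightarrow> \<not> int (6 * (n div \<Prod>A)) dvd (y + e * int (n div \<Prod>A)) - k"
  shows "\<bar>pi / 6 * cot (pi * of_int (y + e * int (n div \<Prod>A)) / (6 * real (n div \<Prod>A)))\<bar> \<le> real n / L"
proof (rule abs_cot_term_le[where d = "\<Prod>A"])
  show "n = \<Prod>A * (n div \<Prod>A)" using prod_prime_factors_subset[OF _ A] n1 by simp
  fix k assume k: "int (6 * (n div \<Prod>A)) dvd (y + e * int (n div \<Prod>A)) - k"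
  show "L < real (\<Prod>A) * \<bar>of_int k\<bar>"
  proof (rule ccontr)
    assume "\<not> ?thesis"
    then have "near n y L A k" using near_of_dvd[OF A e k] by simp
    with far k show False by blast
  qed
qed (use n1 L1 in auto)

lemma cot_pair_small:
  assumes A: "A \<subseteq> prime_factors n" and far: "\<And>k. \<not> near n y L A k"
  shows "\<bar>cot_pair (n div \<Prod>A) y\<bar> \<le> 3 * (real n / L)"
proof -
  have "0 \<le> real n / L" using L1 by simp
  moreover have "\<bar>pi / 6 * cot (pi * of_int (y + e * int (n div \<Prod>A)) / (6 * real (n div \<Prod>A)))\<bar> \<le> real n / L"
    if "e = 1 \<or> e = -1" for e using cot_term_small[OF A that] far by blast
  from this[of 1] this[of "-1"] show ?thesis using calculation cot_pair_split[of 1] by simp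
qed

text \<open>The cotangent with residue k gives the main term with error \<open>2 * (n / L)\<close>.
  The other one adds at most \<open>n / L\<close>, since by \<open>near_unique\<close> a near
  residue of it would be k, which it lacks.\<close>

lemma cot_pair_near:
  assumes A: "A \<subseteq> prime_factors n" and near: "near n y L A' k"
    and dv: "int n dvd int (\<Prod>A) * (y - k)"
  shows "\<bar>cot_pair (n div \<Prod>A) y - real n / real (\<Prod>A) / of_int k\<bar> \<le> 3 * (real n / L)"
proof -
  have k6: "coprime k 6" using near by (simp add: near_def)
  define m where "m = n div \<Prod>A"
  have nm: "n = \<Prod>A * m" and pos: "\<Prod>A > 0" using prod_prime_factors_subset[OF _ A] n1 by (simp_all add: m_def)
  obtain e where e: "e = 1 \<or> e = -1" "int (6 * m) dvd (y + e * int m) - k"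
    "\<not> int (6 * m) dvd (y + (- e) * int m) - k"
    using dvd_of_level[OF A k6 dv] unfolding m_def by blast
  have "- e = 1 \<or> - e = -1" using e(1) by auto
  then have 1: "\<bar>pi / 6 * cot (pi * of_int (y + (- e) * int m) / (6 * real m))\<bar> \<le> real n / L"
    unfolding m_def
    by (rule cot_term_small[OF A]) (use near_unique[OF _ near L2] e(3) in \<open>auto simp: m_def\<close>)
  have "\<bar>pi / 6 * cot (pi * of_int (y + e * int m) / (6 * real m)) - real m / of_int k\<bar> \<le> 2 * (real n / L)"
  proof (rule abs_cot_term_diff_le[OF nm])
    show "k \<noteq> 0" using k6 by auto
    fix k' assume "int (6 * m) dvd (y + e * int m) - k'" "real (\<Prod>A) * \<bar>of_int k'\<bar> \<le> L"
    then have "near n y L A k'" using near_of_dvd[OF A e(1)] by (simp add: m_def)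
    then show "k' = k" using near near_unique L2 by blast
  qed (use n1 L1 L_le e in auto)
  moreover have "real n / real (\<Prod>A) = real m"
    using nm pos by (metis nonzero_mult_div_cancel_left of_nat_eq_0_iff of_nat_mult less_numeral_extra(3))
  ultimately show ?thesis using 1 cot_pair_split[OF e(1), of m] unfolding m_def[symmetric]
    by (simp only:)
qed

lemma cot_sum_far:
  assumes "\<And>A k. \<not> near n y L A k"
  shows "\<bar>cot_sum n y\<bar> \<le> 2 ^ card (prime_factors n) * (3 * (real n / L))"
proof -
  have "\<bar>cot_sum n y\<bar> \<le> (\<Sum>A\<in>Pow (prime_factors n). \<bar>(- 1) ^ card A * cot_pair (n div \<Prod>A) y\<bar>)"
    unfolding cot_sum_def by (rule sum_abs)
  also have "\<dots> \<le> (\<Sum>A\<in>Pow (prime_factors n). 3 * (real n / L))"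
    using cot_pair_small assms by (intro sum_mono) (auto simp: abs_mult)
  finally show ?thesis by (simp add: card_Pow)
qed

lemma cot_sum_near:
  assumes near: "near n y L A' k"
  shows "\<bar>cot_sum n y - (\<Sum>A | A \<subseteq> prime_factors n \<and> int n dvd int (\<Prod>A) * (y - k).
      (- 1) ^ card A * (real n / real (\<Prod>A))) / of_int k\<bar>
    \<le> 2 ^ card (prime_factors n) * (3 * (real n / L))"
proof -
  let ?P = "prime_factors n"
  let ?D = "\<lambda>A. int n dvd int (\<Prod>A) * (y - k)"
  let ?g = "\<lambda>A. if ?D A then real n / real (\<Prod>A) / of_int k else 0"
  have "(\<Sum>A | A \<subseteq> ?P \<and> ?D A. (- 1) ^ card A * (real n / real (\<Prod>A))) / of_int k
      = (\<Sum>A\<in>Pow ?P. (- 1) ^ card A * ?g A)"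
    unfolding sum_divide_distrib by (intro sum.mono_neutral_cong_left) auto
  then have "\<bar>cot_sum n y - (\<Sum>A | A \<subseteq> ?P \<and> ?D A. (- 1) ^ card A * (real n / real (\<Prod>A))) / of_int k\<bar>
      = \<bar>\<Sum>A\<in>Pow ?P. (- 1) ^ card A * (cot_pair (n div \<Prod>A) y - ?g A)\<bar>"
    by (simp only: cot_sum_def right_diff_distrib sum_subtractf)
  also have "\<dots> \<le> (\<Sum>A\<in>Pow ?P. \<bar>(- 1) ^ card A * (cot_pair (n div \<Prod>A) y - ?g A)\<bar>)"
    by (rule sum_abs)
  also have "\<dots> \<le> (\<Sum>A\<in>Pow ?P. 3 * (real n / L))"
  proof (rule sum_mono)
    fix A assume "A \<in> Pow ?P"
    then have A: "A \<subseteq> ?P" by simp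
    have "\<bar>cot_pair (n div \<Prod>A) y - ?g A\<bar> \<le> 3 * (real n / L)"
    proof (cases "?D A")
      case True
      with cot_pair_near[OF A near] show ?thesis by simp
    next
      case False
      \<comment> \<open>By uniqueness a near k' at this level would be k, but k does not represent y
        modulo \<open>n div \<Prod>A\<close>.\<close>
      have "\<not> near n y L A k'" for k'
      proof
        assume *: "near n y L A k'"
        then have "k' = k" by (rule near_unique[OF _ near L2])
        with * False show False by (simp add: near_def)
      qed
      from cot_pair_small[OF A this] False show ?thesis by simp
    qed
    then show "\<bar>(- 1) ^ card A * (cot_pair (n div \<Prod>A) y - ?g A)\<bar> \<le> 3 * (real n / L)"
      by (simp add: abs_mult)
  qed
  finally show ?thesis by (simp add: card_Pow)
qed

text \<open>The sets in question are closed under supersets and, by \<open>gcd_prod_primes\<close>,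
  under intersection. So they are the supersets of a least one, found as a member of least
  cardinality.\<close>

lemma level_sets:
  fixes z :: int
  assumes "A' \<subseteq> prime_factors n" "int n dvd int (\<Prod>A') * z"
  obtains A0 where "A0 \<subseteq> prime_factors n" "int n dvd int (\<Prod>A0) * z"
    "{A. A \<subseteq> prime_factors n \<and> int n dvd int (\<Prod>A) * z} = {A. A0 \<subseteq> A \<and> A \<subseteq> prime_factors n}"
proof -
  let ?Q = "\<lambda>A. A \<subseteq> prime_factors n \<and> int n dvd int (\<Prod>A) * z"
  have "?Q A'" using assms by simp
  then obtain A0 where A0: "?Q A0" and min: "\<And>B. ?Q B \<Longrightarrow> card A0 \<le> card B"
    using ex_has_least_nat[of ?Q A' card] by blast
  have fin: "finite A" if "A \<subseteq> prime_factors n" for A using that by (rule finite_subset) simp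
  have "A0 \<subseteq> B" if B: "?Q B" for B
  proof -
    have "int n dvd gcd (int (\<Prod>A0) * z) (int (\<Prod>B) * z)" using A0 B by simp
    also have "gcd (int (\<Prod>A0) * z) (int (\<Prod>B) * z) = int (gcd (\<Prod>A0) (\<Prod>B)) * \<bar>z\<bar>"
      using gcd_mult_distrib_int[of z "int (\<Prod>A0)" "int (\<Prod>B)"]
      by (simp only: gcd_int_int_eq mult.commute)
    also have "gcd (\<Prod>A0) (\<Prod>B) = \<Prod>(A0 \<inter> B)"
      using A0 B fin by (intro gcd_prod_primes) auto
    finally have "int n dvd int (\<Prod>(A0 \<inter> B)) * z"
      by (metis abs_mult abs_of_nat dvd_abs_iff)
    then have "?Q (A0 \<inter> B)" using A0 by auto
    then have "card A0 \<le> card (A0 \<inter> B)" by (rule min)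
    then have "A0 \<inter> B = A0" using A0 fin by (intro card_seteq) auto
    then show ?thesis by blast
  qed
  moreover have "?Q B" if "A0 \<subseteq> B" "B \<subseteq> prime_factors n" for B
  proof -
    have "\<Prod>B = \<Prod>(B - A0) * \<Prod>A0" using that fin by (intro prod.subset_diff) auto
    then show ?thesis using A0 that by (simp add: mult.assoc)
  qed
  ultimately have "{A. ?Q A} = {A. A0 \<subseteq> A \<and> A \<subseteq> prime_factors n}" by blast
  with A0 show ?thesis by (intro that[of A0]) auto
qed

text \<open>With d0 = \<open>\<Prod>A0\<close> the main term is mu(d0) phi(n) / (k phi(d0)). If
  \<open>A0\<close> is nonempty, phi(d0) is at least 4 because its primes are at least 5; if
  \<open>A0\<close> is empty, the hypothesis excludes \<open>k = -1\<close>.\<close>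

lemma cot_sum_ge:
  assumes "\<not> int n dvd y + 1"
  shows "cot_sum n y \<ge> - real (totient n) / 4 - 2 ^ card (prime_factors n) * (3 * (real n / L))"
proof (cases "\<exists>A k. near n y L A k")
  case False
  then have "\<bar>cot_sum n y\<bar> \<le> 2 ^ card (prime_factors n) * (3 * (real n / L))"
    by (intro cot_sum_far) blast
  moreover have "0 \<le> real (totient n) / 4" by simp
  ultimately show ?thesis by linarith
next
  case True
  then obtain A' k where near: "near n y L A' k" by blast
  let ?f = "\<lambda>A. (- 1) ^ card A * (real n / real (\<Prod>A))"
  from near have near': "A' \<subseteq> prime_factors n" "int n dvd int (\<Prod>A') * (y - k)" "coprime k 6" by (auto simp: near_def)
  from level_sets[OF near'(1,2)] obtain A0 where A0: "A0 \<subseteq> prime_factors n" "int n dvd int (\<Prod>A0) * (y - k)"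
    "{A. A \<subseteq> prime_factors n \<and> int n dvd int (\<Prod>A) * (y - k)} = {A. A0 \<subseteq> A \<and> A \<subseteq> prime_factors n}" .
  have S: "sum ?f {A. A \<subseteq> prime_factors n \<and> int n dvd int (\<Prod>A) * (y - k)}
    = (- 1) ^ card A0 * real (totient n) / real (\<Prod>p\<in>A0. p - 1)"
    unfolding A0(3) using n1 A0(1) by (intro signed_sum_supersets) auto
  have k6: "\<not> 2 dvd k" "\<not> 3 dvd k" using near'(3) by (simp_all add: coprime_6_iff_int)
  have "- real (totient n) / 4 \<le> sum ?f {A. A \<subseteq> prime_factors n \<and> int n dvd int (\<Prod>A) * (y - k)} / of_int k"
  proof (cases "A0 = {}")
    case True
    then have "k \<noteq> -1" using A0(2) assms by auto
    \<comment> \<open>The values 0, -2 and -3 share a factor with 6.\<close>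
    then have "k > 0 \<or> k \<le> -4" using k6 by presburger
    then have "1 / real_of_int k \<ge> - 1 / 4"
      by (auto simp: field_simps)
    then have "real (totient n) * (1 / real_of_int k) \<ge> real (totient n) * (- 1 / 4)"
      by (intro mult_left_mono) auto
    then show ?thesis unfolding S using True by simp
  next
    case False
    then obtain q where q: "q \<in> A0" by blast
    have fin: "finite A0" using A0(1) by (rule finite_subset) simp
    have p5: "p \<ge> 5" if "p \<in> A0" for p
    proof -
      have p: "prime p" using that A0(1) by auto
      have "p \<noteq> 2" "p \<noteq> 3" using prime_factor_coprime_6[OF n6] that A0(1) by auto
      moreover have "p \<noteq> 4" "p \<noteq> 1" "p \<noteq> 0" using p by auto
      ultimately show ?thesis by linarith
    qed
    have "4 * 1 \<le> (q - 1) * (\<Prod>p\<in>A0 - {q}. p - 1)"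
      using p5[OF q] p5 by (intro mult_mono) (force intro!: prod_ge_1)+
    also have "\<dots> = (\<Prod>p\<in>A0. p - 1)" using fin q by (simp add: prod.remove)
    finally have "4 \<le> real (\<Prod>p\<in>A0. p - 1)" by (metis mult_1_right of_nat_le_iff of_nat_numeral)
    moreover have "1 \<le> \<bar>real_of_int k\<bar>" using k6 by (cases "k = 0") auto
    ultimately have "4 * 1 \<le> real (\<Prod>p\<in>A0. p - 1) * \<bar>real_of_int k\<bar>" by (intro mult_mono) auto
    then have "real (totient n) / (real (\<Prod>p\<in>A0. p - 1) * \<bar>real_of_int k\<bar>) \<le> real (totient n) / 4"
      by (intro divide_left_mono) auto
    moreover have "\<bar>(- 1) ^ card A0 * real (totient n) / real (\<Prod>p\<in>A0. p - 1) / of_int k\<bar>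
      = real (totient n) / (real (\<Prod>p\<in>A0. p - 1) * \<bar>real_of_int k\<bar>)"
      by (simp add: abs_mult power_abs del: of_nat_prod)
    ultimately show ?thesis unfolding S by linarith
  qed
  then show ?thesis using cot_sum_near[OF near] by linarith
qed

text \<open>Here \<open>k = 1\<close> represents y modulo n itself, so every set of primes counts
  and the main term is all of phi(n).\<close>

lemma cot_sum_ge_1:
  assumes "int n dvd y - 1"
  shows "cot_sum n y \<ge> real (totient n) - 2 ^ card (prime_factors n) * (3 * (real n / L))"
proof -
  have near: "near n y L {} 1" using assms L1 by (simp add: near_def)
  have eq: "{A. A \<subseteq> prime_factors n \<and> int n dvd int (\<Prod>A) * (y - 1)} = {A. {} \<subseteq> A \<and> A \<subseteq> prime_factors n}"
    using assms by auto
  from cot_sum_near[OF near] have "\<bar>cot_sum n y - real (totient n)\<bar>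
    \<le> 2 ^ card (prime_factors n) * (3 * (real n / L))"
    unfolding eq using signed_sum_supersets[of n "{}"] n1 by simp
  then show ?thesis by linarith
qed

end

section \<open>Sequences of length four\<close>

lemma size_mult_le_sum_mset:
  fixes f :: "'a \<Rightarrow> 'b::linordered_semidom"
  assumes "\<And>a. a \<in># S \<Longrightarrow> c \<le> f a"
  shows "of_nat (size S) * c \<le> (\<Sum>a\<in>#S. f a)"
  using assms
proof (induction S)
  case (add a S)
  then have "c + of_nat (size S) * c \<le> f a + (\<Sum>a\<in>#S. f a)" by (intro add_mono) simp_all
  then show ?case by (simp add: distrib_right)
qed simp

text \<open>Each sum is a multiple of n strictly between 0 and \<open>4 * n\<close>. The value n
  would make the index 1, and the value \<open>3 * n\<close> at g would become n at
  \<open>n - g\<close>.\<close>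

lemma balanced_of_seq_index_ne_1:
  assumes n: "n > 1" and "zero_sum n S" "size S = 4" and co: "\<And>a. a \<in># S \<Longrightarrow> coprime a n"
    and ne: "seq_index n S \<noteq> 1" and g: "g < n" "coprime g n"
  shows "(\<Sum>a\<in>#S. (g * a) mod n) = 2 * n"
proof -
  define s where "s g = (\<Sum>a\<in>#S. (g * a) mod n)" for g
  have pos: "0 < g * a mod n" if "coprime g n" "a \<in># S" for g a
  proof (rule ccontr)
    assume "\<not> ?thesis"
    then have "n dvd g * a" by (simp add: mod_eq_0_iff_dvd)
    moreover have "coprime (g * a) n" using that co by simp
    ultimately have "n = 1" by (metis coprime_common_divisor_nat dvd_refl nat_dvd_1_iff_1)
    with n show False by simp
  qed
  have cases: "s g = n \<or> s g = 2 * n \<or> s g = 3 * n" if "coprime g n" for g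
  proof -
    have "[s g = (\<Sum>a\<in>#S. g * a)] (mod n)" unfolding s_def
    proof (induction S)
      case (add a S)
      have "[g * a mod n = g * a] (mod n)" by (simp add: cong_def)
      from cong_add[OF this add.IH] show ?case by simp
    qed simp
    also have "(\<Sum>a\<in>#S. g * a) = g * \<Sum>\<^sub># S" by (induction S) (auto simp: algebra_simps)
    also have "[\<dots> = g * 0] (mod n)" using assms(2) unfolding zero_sum_def by (intro cong_mult cong_refl)
    finally have "n dvd s g" by (simp add: cong_0_iff)
    then obtain j where j: "s g = n * j" by blast
    have "of_nat (size S) * 1 \<le> s g" unfolding s_def
      by (rule size_mult_le_sum_mset) (use pos[OF that] in force)
    then have "j > 0" using j assms(3) by (cases j) auto
    \<comment> \<open>The upper bound for \<open>s g\<close> comes from the complements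
      \<open>n - g * a mod n\<close>, each at least 1.\<close>
    have "of_nat (size S) * 1 \<le> (\<Sum>a\<in>#S. n - g * a mod n)"
      by (rule size_mult_le_sum_mset) (use n in \<open>simp add: Suc_leI\<close>)
    moreover have "n - g * a mod n + g * a mod n = n" for a using n by (simp add: less_imp_le)
    then have "(\<Sum>a\<in>#S. n - g * a mod n) + s g = size S * n"
      unfolding s_def sum_mset.distrib[symmetric] by (simp only: sum_mset_constant of_nat_id)
    ultimately have "s g < 4 * n" using assms(3) by simp
    then have "j < 4" using j by simp
    with \<open>j > 0\<close> have "j = 1 \<or> j = 2 \<or> j = 3" by linarith
    with j show ?thesis by auto
  qed
  have ne_n: "s g \<noteq> n" if g: "g < n" "coprime g n" for g
  proof
    assume "s g = n"
    let ?X = "{1 / real n * real (\<Sum>a\<in>#S. (g * a) mod n) | g. 1 \<le> g \<and> g < n \<and> gcd g n = 1}"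
    have "g \<ge> 1" using g n by (cases "g = 0") auto
    have "Min ?X = 1"
    proof (rule Min_eqI)
      have "?X \<subseteq> (\<lambda>g. 1 / real n * real (\<Sum>a\<in>#S. (g * a) mod n)) ` {..<n}" by auto
      then show "finite ?X" by (rule finite_subset) simp
      have "1 = 1 / real n * real (\<Sum>a\<in>#S. (g * a) mod n)"
        using \<open>s g = n\<close> n unfolding s_def by simp
      then show "1 \<in> ?X" using g \<open>g \<ge> 1\<close> unfolding mem_Collect_eq by (intro exI[of _ g]) simp
      fix x assume "x \<in> ?X"
      then obtain h where h: "x = 1 / real n * real (s h)" "gcd h n = 1"
        unfolding mem_Collect_eq s_def by (elim exE conjE)
      have "real n \<le> real (s h)" using cases[of h, unfolded coprime_iff_gcd_eq_1, OF h(2)] by auto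
      then show "1 \<le> x" using h(1) n by simp
    qed
    with ne show False by (simp add: seq_index_def)
  qed
  have g0: "g > 0" using g n by (cases "g = 0") auto
  have "s (n - g) + s g = size S * n"
  proof -
    have "(n - g) * a mod n + g * a mod n = n" if "a \<in># S" for a
    proof -
      have "(n - g) * a + g * a = n * a" using g(1) by (simp add: diff_mult_distrib)
      then have "n dvd (n - g) * a mod n + g * a mod n"
        by (metis dvd_triv_left mod_add_eq mod_eq_0_iff_dvd)
      then obtain j where j: "(n - g) * a mod n + g * a mod n = n * j" by blast
      have "n * j < n + n" unfolding j[symmetric] using n by (intro add_strict_mono) auto
      then have "n * j < n * 2" by (simp only: mult_2_right)
      then have "j < 2" by simp
      moreover have "j > 0" using j pos[OF g(2) that] by (cases "j = 0") auto
      ultimately have "j = 1" by simp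
      with j show ?thesis by simp
    qed
    then have "(\<Sum>a\<in>#S. (n - g) * a mod n + g * a mod n) = (\<Sum>a\<in>#S. n)"
      by (intro arg_cong[where f = sum_mset] image_mset_cong)
    then show ?thesis unfolding s_def sum_mset.distrib[symmetric] by (simp only: sum_mset_constant of_nat_id)
  qed
  moreover have "s (n - g) \<noteq> n"
  proof (rule ne_n)
    show "n - g < n" using g0 g by simp
    show "coprime (n - g) n"
      using g by (simp add: coprime_diff_left_iff)
  qed
  ultimately show ?thesis using cases[OF g(2)] ne_n[OF g] assms(3) by (auto simp: s_def)
qed

theorem theorem1p4:
  fixes n :: nat and S :: "nat multiset"
  assumes "real n > 4.6 * 10 ^ 13"
    and "gcd n 6 = 1"
    and "seq_over n S"
    and "size S = 4"
    and "minimal_zero_sum n S"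
    and "\<forall>a\<in>#S. gcd n a = 1"
  shows "seq_index n S = 1"
proof (rule ccontr)
  assume ne: "seq_index n S \<noteq> 1"
  have n6: "coprime n 6" using assms(2) by (simp only: coprime_iff_gcd_eq_1)
  have n: "n > 1" using assms(1) by (cases "n \<le> 1") (auto simp: le_Suc_eq)
  have co: "coprime a n" if "a \<in># S" for a using that assms(6) by (simp only: coprime_iff_gcd_eq_1 gcd.commute[of a n])
  have zs: "zero_sum n S" and min: "\<And>T. T \<subset># S \<Longrightarrow> T \<noteq> {#} \<Longrightarrow> \<not> zero_sum n T"
    using assms(5) by (auto simp: minimal_zero_sum_def)
  have "\<exists>k. [a * k = 1] (mod n)" if "a \<in># S" for a using co[OF that] cong_solve_coprime_nat by auto
  then obtain k where k: "\<And>a. a \<in># S \<Longrightarrow> [a * k a = 1] (mod n)" by metis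
  obtain w where w: "[6 * w = 1] (mod n)" using n6 cong_solve_coprime_nat[of 6 n] by (auto simp: coprime_commute)
  obtain b T where S: "S = add_mset b T" using assms(4) by (metis multiset_cases size_empty zero_neq_numeral)
  \<comment> \<open>Since \<open>w\<close> inverts 6 and \<open>k a\<close> inverts a,
    \<open>y a\<close> represents b / a modulo n and is, as an integer, a multiple of 6, as the
    estimates require; \<open>y b\<close> is congruent to 1.\<close>
  define y where "y a = 6 * (int (b * w) * int (k a))" for a
  have cw: "coprime w n" using w by (metis cong_imp_coprime coprime_1_left coprime_mult_left_iff cong_sym)
  have sum0: "(\<Sum>a\<in>#S. cot_sum n (y a)) = 0" unfolding y_def
  proof (rule sum_cot_sum_eq_0[OF n n6])
    show "(\<Sum>a\<in>#S. g * a mod n) = 2 * n" if "g < n" "coprime g n" for g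
      using balanced_of_seq_index_ne_1[OF n zs assms(4) co ne that] .
    show "coprime (int (b * w)) (int n)" using cw co S by simp
  qed (rule k)
  have ya: "[int a * y a = int b] (mod int n)" if "a \<in># S" for a
  proof -
    have "[(a * k a) * (6 * w) * b = 1 * 1 * b] (mod n)" using k[OF that] w by (intro cong_mult cong_refl)
    then have "[int ((a * k a) * (6 * w) * b) = int (1 * 1 * b)] (mod int n)" by (simp only: cong_int_iff)
    then show ?thesis by (simp add: y_def mult_ac)
  qed
  \<comment> \<open>This gives \<open>2 * L\<^sup>2 = n / 2\<close>, enough for uniqueness of near
    representatives, and \<open>n / L = 2 * sqrt n\<close>.\<close>
  define L where "L = sqrt (real n) / 2"
  have s1: "sqrt (real n) \<ge> 2" using assms(1) by (intro real_le_rsqrt) simp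
  have L: "L \<ge> 1" "2 * L\<^sup>2 < real n" using s1 n by (auto simp: L_def power_divide)
  have "real n / L = 2 * (real n / sqrt (real n))" by (simp add: L_def)
  then have nL: "real n / L = 2 * sqrt (real n)" by (simp only: real_div_sqrt of_nat_0_le_iff)
  have y6: "6 dvd y a" for a by (simp add: y_def)
  define E where "E = 2 ^ card (prime_factors n) * (3 * (real n / L))"
  have b: "cot_sum n (y b) \<ge> real (totient n) - E"
  proof -
    have bS: "b \<in># S" by (simp add: S)
    have "[int (b * k b) = int 1] (mod int n)" using k[OF bS] by (simp only: cong_int_iff)
    then have kb: "[int (k b) * int b = 1] (mod int n)" by (simp add: mult.commute)
    then have "[int (k b) * int b * y b = 1 * y b] (mod int n)" by (intro cong_mult cong_refl)
    moreover have "[int (k b) * (int b * y b) = int (k b) * int b] (mod int n)"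
      using ya[OF bS] by (intro cong_mult cong_refl)
    ultimately have "[y b = 1] (mod int n)" using kb
      by (metis cong_sym cong_trans mult.assoc mult_1)
    then have "int n dvd y b - 1" by (simp add: cong_iff_dvd_diff)
    from cot_sum_ge_1[OF n n6 y6 L this] show ?thesis by (simp add: E_def)
  qed
  have "cot_sum n (y a) \<ge> - real (totient n) / 4 - E" if a: "a \<in># T" for a
  proof -
    \<comment> \<open>Otherwise a + b would vanish modulo n, giving a proper zero-sum subsequence of
      length 2.\<close>
    have "\<not> int n dvd y a + 1"
    proof
      assume "int n dvd y a + 1"
      then have "int n dvd int a * (y a + 1)" by simp
      moreover have "int n dvd int a * y a - int b" using ya[of a] a S by (simp add: cong_iff_dvd_diff)
      ultimately have "int n dvd int a * (y a + 1) - (int a * y a - int b)" by (rule dvd_diff)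
      then have "int n dvd int (a + b)" by (simp add: algebra_simps)
      then have "zero_sum n {#b, a#}" by (simp add: zero_sum_def cong_0_iff add.commute del: of_nat_add)
      moreover have "{#b, a#} \<subset># S"
      proof (rule subset_mset.le_neq_trans)
        show "{#b, a#} \<subseteq># S" using a by (simp add: S)
        show "{#b, a#} \<noteq> S" using assms(4) by auto
      qed
      ultimately show False using min[of "{#b, a#}"] by simp
    qed
    from cot_sum_ge[OF n n6 y6 L this] show ?thesis by (simp add: E_def)
  qed
  then have "of_nat (size T) * (- real (totient n) / 4 - E) \<le> (\<Sum>a\<in>#T. cot_sum n (y a))"
    by (rule size_mult_le_sum_mset)
  moreover have "size T = 3" using assms(4) S by simp
  \<comment> \<open>One term is at least phi(n) - E and three are at least -phi(n) / 4 - E, so a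
    total of 0 forces phi(n) / 4 to be at most 4 E. As E is 6 times 2^omega(n) sqrt(n), this yields
    the constant 96.\<close>
  ultimately have "real (totient n) \<le> 16 * E" using sum0 b S by simp
  also have "\<dots> = 96 * (2 ^ card (prime_factors n) * sqrt (real n)) * 1" by (simp add: E_def nL)
  finally show False using totient_gt[OF n6 assms(1)] by simp
qed

end
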